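(* Restricting the basic character of generalized permutahedra to $\overline{\mathrm{OP}}$ produces the character $\zeta\in\mathbb{X}(\overline{\mathrm{OP}})$ defined by $$\zeta_I(\mathcal{O}_{\alpha})=\begin{cases}1&\text{if }\alpha\text{ has only one part},\\0&\text{otherwise}\end{cases}$$ when $I$ is a finite set and $\alpha$ is an integer composition of $|I|$.
   Context: For a finite set $I$, $\mathbb{R}I$ is the real vector space with basis $\{e_i:i\in I\}$ and $\mathbb{R}^I$ its dual. For a face $F\le P$ of a polytope $P\subset\mathbb{R}I$, $\mathcal{N}_P(F)$ is the cone of $y\in\mathbb{R}^I$ attaining their maximum over $P$ at every point of $F$; $\mathcal{N}_P=\{\mathcal{N}_P(F):F\le P\}$ is the normal fan; $P,Q$ are normally equivalent if $\mathcal{N}_P=\mathcal{N}_Q$. A generalized permutahedron in $\mathbb{R}I$ is a polytope whose normal fan is a coarsening of the braid fan in $\mathbb{R}^I$ (the fan formed by the faces of the closed regions of the arrangement of hyperplanes $y_i=y_j$, $i\ne j$), meaning each cone of the braid fan is contained in a cone of the normal fan. $\mathrm{GP}[I]$ denotes the set of generalized permutahedra in $\mathbb{R}I$. The basic character $\zeta$ of generalized permutahedra, with values in a field $\Bbbk$, is $\zeta_I(P)=1$ if $P\in\mathrm{GP}[I]$ is a point and $\zeta_I(P)=0$ otherwise. The symmetric group $\mathfrak{S}_I$ acts on $\mathbb{R}I$ by $\sigma(p)_i=p_{\sigma^{-1}(i)}$; the orbit polytope of $p\in\mathbb{R}I$ is $\mathcal{O}(p)=\operatorname{conv}\{\sigma(p):\sigma\in\mathfrak{S}_I\}$,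 which is a generalized permutahedron. A composition of $n$ is a finite sequence of positive integers (parts) with sum $n$. The composition of $p\in\mathbb{R}I$ is $(\alpha_1,\dots,\alpha_k)$ where $\alpha_j$ is the number of coordinates of $p$ equal to the $j$-th largest distinct coordinate value; the composition of an orbit polytope is the composition of any of its vertices. Two orbit polytopes in $\mathbb{R}I$ are normally equivalent iff they have the same composition; $\mathcal{O}_\alpha=\mathcal{O}_{\alpha,I}$ is the normal equivalence class of orbit polytopes in $\mathbb{R}I$ with composition $\alpha$. For polytopes $P\subset\mathbb{R}S$, $Q\subset\mathbb{R}T$, $S\cap T=\varnothing$, $P\cdot Q=\{(p,q):p\in P,q\in Q\}$. $\overline{\mathrm{OP}}[I]$ is the set of normal equivalence classes of finite products of orbit polytopes in $\mathbb{R}I$, i.e. of elements $\mathcal{O}_{\alpha_1,S_1}\cdots\mathcal{O}_{\alpha_k,S_k}$ with $I=S_1\sqcup\dots\sqcup S_k$ and $\alpha_i$ a composition of $|S_i|$; bijections of label sets act by relabeling. A character of $\overline{\mathrm{OP}}$ is a collection of maps $\zeta_I:\overline{\mathrm{OP}}[I]\to\Bbbk$, one for each finite set $I$, natural under bijections of finite sets, sending the unique element of $\overline{\mathrm{OP}}[\varnothing]$ to $1$, and with $\zeta_{S\sqcup T}(x\cdot y)=\zeta_S(x)\zeta_T(y)$; $\mathbb{X}(\overline{\mathrm{OP}})$ is the set of characters. A character is determined by its values on the elements $\mathcal{O}_{\alpha,I}$. Restriction to $\overline{\mathrm{OP}}$ means evaluating the basic character on any representative of a normal equivalence class.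
   Formalization: The displayed formula is asserted for nonempty I only: for I empty the sole composition has no parts, so the formula would give 0, while every character takes the value 1 there. *)

theory Defs
  imports
    "HOL-Analysis.Analysis"
    "HOL-Library.Function_Algebras"
    "HOL-Combinatorics.Permutations"
begin

instantiation "fun" :: (type, real_vector) real_vector
begin

definition scaleR_fun :: "real \<Rightarrow> ('a \<Rightarrow> 'b) \<Rightarrow> 'a \<Rightarrow> 'b"
  where "scaleR_fun c f = (\<lambda>x. c *\<^sub>R f x)"

instance
  by standard (simp_all add: scaleR_fun_def fun_eq_iff scaleR_add_right scaleR_add_left)

end

(* Label sets are finite subsets I of an arbitrary type 'a.  A vector of RI is represented by
   its coordinate function, extended by 0 outside I; then RS and RT are subspaces of R(S \<union> T),
   and for disjoint S, T the pair (p, q) in RS x RT = R(S \<union> T) is the sum p + q.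
   The dual R^I has the same underlying set: y stands for the functional "pairing I y". *)

definition RR :: "'a set \<Rightarrow> ('a \<Rightarrow> real) set"
  where "RR I = {p. \<forall>i. i \<notin> I \<longrightarrow> p i = 0}"

definition pairing :: "'a set \<Rightarrow> ('a \<Rightarrow> real) \<Rightarrow> ('a \<Rightarrow> real) \<Rightarrow> real"
  where "pairing I y p = (\<Sum>i\<in>I. y i * p i)"

definition polytopes :: "'a set \<Rightarrow> ('a \<Rightarrow> real) set set"
  where "polytopes I = {P. polytope P \<and> P \<subseteq> RR I}"

definition normal_cone :: "'a set \<Rightarrow> ('a \<Rightarrow> real) set \<Rightarrow> ('a \<Rightarrow> real) set \<Rightarrow> ('a \<Rightarrow> real) set"
  where "normal_cone I P F = {y \<in> RR I. \<forall>x\<in>F. \<forall>z\<in>P. pairing I y z \<le> pairing I y x}"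

(* "face_of" also admits the empty set, whose normal cone would be all of R^I; as usual, normal
   fans are indexed by the nonempty faces only. *)

definition normal_fan :: "'a set \<Rightarrow> ('a \<Rightarrow> real) set \<Rightarrow> ('a \<Rightarrow> real) set set"
  where "normal_fan I P = {normal_cone I P F |F. F face_of P \<and> F \<noteq> {}}"

definition normal_equiv :: "'a set \<Rightarrow> (('a \<Rightarrow> real) set \<times> ('a \<Rightarrow> real) set) set"
  where "normal_equiv I =
    {(P, Q). P \<in> polytopes I \<and> Q \<in> polytopes I \<and> normal_fan I P = normal_fan I Q}"

(* Closures and components are taken in the product topology, which restricts to the usual
   topology on the closed subset RR I for finite I. *)

definition braid_hyperplane :: "'a set \<Rightarrow> 'a \<Rightarrow> 'a \<Rightarrow> ('a \<Rightarrow> real) set"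
  where "braid_hyperplane I i j = {y \<in> RR I. y i = y j}"

definition braid_complement :: "'a set \<Rightarrow> ('a \<Rightarrow> real) set"
  where "braid_complement I =
    RR I - \<Union>{braid_hyperplane I i j |i j. i \<in> I \<and> j \<in> I \<and> i \<noteq> j}"

definition braid_fan :: "'a set \<Rightarrow> ('a \<Rightarrow> real) set set"
  where "braid_fan I =
    {C. C \<noteq> {} \<and> (\<exists>R\<in>components (braid_complement I). C face_of closure R)}"

definition GP :: "'a set \<Rightarrow> ('a \<Rightarrow> real) set set"
  where "GP I = {P \<in> polytopes I. \<forall>B\<in>braid_fan I. \<exists>N\<in>normal_fan I P. B \<subseteq> N}"

definition basic_character :: "'a set \<Rightarrow> ('a \<Rightarrow> real) set \<Rightarrow> 'k::field"
  where "basic_character =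
    (\<lambda>I\<in>{I. finite I}. \<lambda>P\<in>GP I. if \<exists>p. P = {p} then 1 else 0)"

definition orbit_polytope :: "'a set \<Rightarrow> ('a \<Rightarrow> real) \<Rightarrow> ('a \<Rightarrow> real) set"
  where "orbit_polytope I p = convex hull {\<lambda>i. p (inv \<sigma> i) |\<sigma>. \<sigma> permutes I}"

definition is_composition :: "nat list \<Rightarrow> nat \<Rightarrow> bool"
  where "is_composition \<alpha> n \<longleftrightarrow> (\<forall>a\<in>set \<alpha>. 0 < a) \<and> sum_list \<alpha> = n"

definition composition_of :: "'a set \<Rightarrow> ('a \<Rightarrow> real) \<Rightarrow> nat list"
  where "composition_of I p =
    map (\<lambda>v. card {i \<in> I. p i = v}) (rev (sorted_list_of_set (p ` I)))"

(* The members of the normal equivalence class include polytopes that are not themselves orbit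
   polytopes.  All orbit polytopes of composition \<alpha> are normally equivalent, so the image of
   this set of polytopes under the relation is a single class. *)

definition orbit_class :: "nat list \<Rightarrow> 'a set \<Rightarrow> ('a \<Rightarrow> real) set set"
  where "orbit_class \<alpha> I =
    normal_equiv I `` {orbit_polytope I p |p. p \<in> RR I \<and> composition_of I p = \<alpha>}"

definition polytope_mult :: "('a \<Rightarrow> real) set \<Rightarrow> ('a \<Rightarrow> real) set \<Rightarrow> ('a \<Rightarrow> real) set"
  where "polytope_mult P Q = {p + q |p q. p \<in> P \<and> q \<in> Q}"

inductive orbit_product :: "'a set \<Rightarrow> ('a \<Rightarrow> real) set \<Rightarrow> bool"
  where
    empty: "orbit_product {} {0}"
  | mult: "orbit_product S P \<Longrightarrow> finite T \<Longrightarrow> S \<inter> T = {} \<Longrightarrow> q \<in> RR T \<Longrightarrow>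
      orbit_product (S \<union> T) (polytope_mult P (orbit_polytope T q))"

definition OP_bar :: "'a set \<Rightarrow> ('a \<Rightarrow> real) set set set"
  where "OP_bar I = {normal_equiv I `` {P} |P. orbit_product I P}"

definition class_mult ::
    "'a set \<Rightarrow> 'a set \<Rightarrow> ('a \<Rightarrow> real) set set \<Rightarrow> ('a \<Rightarrow> real) set set \<Rightarrow> ('a \<Rightarrow> real) set set"
  where "class_mult S T x y = normal_equiv (S \<union> T) `` {polytope_mult P Q |P Q. P \<in> x \<and> Q \<in> y}"

definition relabel :: "('a \<Rightarrow> 'a) \<Rightarrow> 'a set \<Rightarrow> 'a set \<Rightarrow> ('a \<Rightarrow> real) \<Rightarrow> ('a \<Rightarrow> real)"
  where "relabel f I J p = (\<lambda>j. if j \<in> J then p (inv_into I f j) else 0)"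

definition class_relabel ::
    "('a \<Rightarrow> 'a) \<Rightarrow> 'a set \<Rightarrow> 'a set \<Rightarrow> ('a \<Rightarrow> real) set set \<Rightarrow> ('a \<Rightarrow> real) set set"
  where "class_relabel f I J x = (\<lambda>P. relabel f I J ` P) ` x"

(* Families are extensional (undefined off their domain), so that equality of characters is
   equality of their values on all elements of OP_bar I, I finite. *)

definition OP_characters :: "('a set \<Rightarrow> ('a \<Rightarrow> real) set set \<Rightarrow> 'k::field) set"
  where "OP_characters =
    {\<zeta> \<in> (\<Pi>\<^sub>E I\<in>{I. finite I}. OP_bar I \<rightarrow>\<^sub>E UNIV).
      (\<forall>I J f x. finite I \<and> finite J \<and> bij_betw f I J \<and> x \<in> OP_bar I \<longrightarrow>
         \<zeta> J (class_relabel f I J x) = \<zeta> I x) \<and>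
      (\<forall>x\<in>OP_bar {}. \<zeta> {} x = 1) \<and>
      (\<forall>S T x y. finite S \<and> finite T \<and> S \<inter> T = {} \<and> x \<in> OP_bar S \<and> y \<in> OP_bar T \<longrightarrow>
         \<zeta> (S \<union> T) (class_mult S T x y) = \<zeta> S x * \<zeta> T y)}"

(* For I = {} the only composition is the empty one and the value is fixed to 1 by the axioms of
   a character; the formula of the statement therefore concerns nonempty I. *)

definition has_one_part_values :: "('a set \<Rightarrow> ('a \<Rightarrow> real) set set \<Rightarrow> 'k::field) \<Rightarrow> bool"
  where "has_one_part_values \<zeta> \<longleftrightarrow>
    (\<forall>I \<alpha>. finite I \<and> I \<noteq> {} \<and> is_composition \<alpha> (card I) \<longrightarrow>
       \<zeta> I (orbit_class \<alpha> I) = (if length \<alpha> = 1 then 1 else 0))"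

definition is_restriction_of_basic ::
    "('a set \<Rightarrow> ('a \<Rightarrow> real) set set \<Rightarrow> 'k::field) \<Rightarrow> bool"
  where "is_restriction_of_basic \<zeta> \<longleftrightarrow>
    (\<forall>I. finite I \<longrightarrow> (\<forall>x\<in>OP_bar I. \<forall>P\<in>x. P \<in> GP I \<and> \<zeta> I x = basic_character I P))"

end

theory Submission
  imports Defs
begin

text \<open>
  For a convex set \<open>P\<close> the normal fan consists of the cones \<open>normal_cone I P W\<close> with
  \<open>\<emptyset> \<noteq> W \<subseteq> P\<close>. Hence being a point is a property of the normal fan: it says that the fan
  is \<open>{RR I}\<close>. The fan of a product of polytopes in complementary coordinates consists of the
  products of cones of the factors, so products of classes are well defined, and a product is a
  point iff both factors are. By the rearrangement inequality a functional \<open>y\<close> is maximal at a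
  vertex \<open>v\<close> of an orbit polytope iff \<open>y\<close> and \<open>v\<close> are weakly ordered alike. So the fan depends
  only on the composition, and one vertex is maximal for all functionals in a closed braid
  chamber, which makes products of orbit polytopes generalized permutahedra.
\<close>

text \<open>A class contains every polytope with the right fan, whether or not it is a product of
  orbit polytopes, so each claim about a class has to be read off a fan. Fans are indexed by faces,
  and the faces of hulls, products and relabeled polytopes would be laborious to describe. Arbitrary
  nonempty point sets \<open>W\<close> are easy to move around instead: they can be projected to the
  factors of a product, multiplied, relabeled, or replaced by sets of generators of a hull. The last
  move computes the fan of an orbit polytope from the finite orbit alone, which is where the
  rearrangement inequality applies. A character with the stated values is unique because every
  element of \<open>OP_bar\<close> is a product of classes of orbit polytopes. The formula has
  content only because every composition is the composition of some vector, so that the classes of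
  orbit polytopes are nonempty.\<close>

section \<open>Linear functionals, faces and normal fans\<close>

lemma linear_pairing: "linear (pairing I y)"
  by (rule linearI)
    (simp_all add: pairing_def scaleR_fun_def algebra_simps sum.distrib sum_distrib_left)

lemma RR_add: "p \<in> RR I \<Longrightarrow> q \<in> RR I \<Longrightarrow> p + q \<in> RR I"
  by (simp add: RR_def)

lemma RR_mono: "S \<subseteq> T \<Longrightarrow> RR S \<subseteq> RR T"
  by (auto simp: RR_def)

lemma convex_RR: "convex (RR I)"
  by (rule convexI) (simp add: RR_def scaleR_fun_def)

text \<open>A weighted mean of two values, neither above the maximum, reaches the maximum only if
  both do. The set \<open>Y\<close> is arbitrary because it will be a whole normal cone.\<close>

lemma face_of_maximizers:
  assumes "convex P"
  shows "{x \<in> P. \<forall>y\<in>Y. \<forall>z\<in>P. pairing I y z \<le> pairing I y x} face_of P" (is "?F face_of P")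
  unfolding face_of_def
proof (intro conjI ballI impI)
  show "?F \<subseteq> P" by blast
  show "convex ?F"
  proof (rule convexI)
    fix a b and u v :: real
    assume ab: "a \<in> ?F" "b \<in> ?F" and uv: "0 \<le> u" "0 \<le> v" "u + v = 1"
    have "pairing I y z \<le> pairing I y (u *\<^sub>R a + v *\<^sub>R b)" if "y \<in> Y" "z \<in> P" for y z
    proof -
      have "u * pairing I y z + v * pairing I y z \<le> u * pairing I y a + v * pairing I y b"
        using ab that uv by (intro add_mono mult_left_mono) auto
      then show ?thesis
        using uv by (simp add: linear_add[OF linear_pairing] linear_cmul[OF linear_pairing]
            flip: distrib_right)
    qed
    moreover have "u *\<^sub>R a + v *\<^sub>R b \<in> P"
      using assms ab uv by (auto simp: convex_def)
    ultimately show "u *\<^sub>R a + v *\<^sub>R b \<in> ?F" by blast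
  qed
next
  fix a b x
  assume a: "a \<in> P" and b: "b \<in> P" and x: "x \<in> ?F" and seg: "x \<in> open_segment a b"
  obtain t where t: "0 < t" "t < 1" "x = (1 - t) *\<^sub>R a + t *\<^sub>R b"
    using seg by (auto simp: in_segment)
  have eq: "pairing I y a = pairing I y x \<and> pairing I y b = pairing I y x" if "y \<in> Y" for y
  proof -
    have ux: "pairing I y x = (1 - t) * pairing I y a + t * pairing I y b"
      using t by (simp add: linear_add[OF linear_pairing] linear_cmul[OF linear_pairing])
    have le: "pairing I y a \<le> pairing I y x" "pairing I y b \<le> pairing I y x"
      using x a b that by auto
    \<comment> \<open>The two deficits are nonnegative and their positively weighted sum vanishes,
      so both vanish.\<close>
    have split: "(1 - t) * (pairing I y x - pairing I y a) + t * (pairing I y x - pairing I y b) = 0"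
      using ux by (simp add: algebra_simps)
    have "0 \<le> (1 - t) * (pairing I y x - pairing I y a)"
      "0 \<le> t * (pairing I y x - pairing I y b)"
      using le t by auto
    with split have "(1 - t) * (pairing I y x - pairing I y a) = 0"
      "t * (pairing I y x - pairing I y b) = 0"
      by linarith+
    then show ?thesis using t by auto
  qed
  then show "a \<in> ?F" "b \<in> ?F" using a b x by auto
qed

text \<open>Faces of a polytope are exposed, but this is not needed: the points of \<open>P\<close> at which all
  functionals of \<open>normal_cone I P W\<close> are maximal form a face with the same normal cone as \<open>W\<close>.\<close>

lemma normal_fan_eq:
  assumes "convex P"
  shows "normal_fan I P = {normal_cone I P W |W. W \<subseteq> P \<and> W \<noteq> {}}"
proof (intro equalityI subsetI)
  fix N assume "N \<in> normal_fan I P"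
  then show "N \<in> {normal_cone I P W |W. W \<subseteq> P \<and> W \<noteq> {}}"
    unfolding normal_fan_def using face_of_imp_subset by blast
next
  fix N assume "N \<in> {normal_cone I P W |W. W \<subseteq> P \<and> W \<noteq> {}}"
  then obtain W where W: "W \<subseteq> P" "W \<noteq> {}" "N = normal_cone I P W" by blast
  let ?F = "{x \<in> P. \<forall>y\<in>N. \<forall>z\<in>P. pairing I y z \<le> pairing I y x}"
  have "W \<subseteq> ?F" using W by (auto simp: normal_cone_def)
  moreover have "normal_cone I P ?F = N"
  proof
    show "normal_cone I P ?F \<subseteq> N"
      using \<open>W \<subseteq> ?F\<close> unfolding W(3) normal_cone_def by blast
    show "N \<subseteq> normal_cone I P ?F"
      unfolding W(3) normal_cone_def by blast
  qed
  ultimately show "N \<in> normal_fan I P"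
    using face_of_maximizers[OF assms, of N I] W(2) unfolding normal_fan_def by blast
qed

section \<open>The fan of the convex hull of a finite set\<close>

lemma pairing_le_convex_hull:
  assumes "\<And>z. z \<in> V \<Longrightarrow> pairing I y z \<le> c" and "x \<in> convex hull V"
  shows "pairing I y x \<le> c"
proof -
  have "convex {z. pairing I y z \<le> c}"
  proof -
    have "{z. pairing I y z \<le> c} = pairing I y -` {..c}" by auto
    then show ?thesis
      using convex_linear_vimage[OF linear_pairing convex_real_interval(2)] by simp
  qed
  then have "convex hull V \<subseteq> {z. pairing I y z \<le> c}"
    using assms(1) by (intro hull_minimal) auto
  then show ?thesis using assms(2) by blast
qed

lemma normal_cone_convex_hull: "normal_cone I (convex hull V) W = normal_cone I V W"
proof -
  have "(\<forall>z\<in>convex hull V. pairing I y z \<le> c) \<longleftrightarrow> (\<forall>z\<in>V. pairing I y z \<le> c)" for y c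
    using pairing_le_convex_hull[of V I y c] hull_subset[of V convex] by blast
  then show ?thesis by (simp add: normal_cone_def)
qed

text \<open>Take \<open>W\<close> to be the generators with positive weight in some convex
  combination giving \<open>x\<close>. A weighted mean equals the maximum exactly when every value
  of positive weight does.\<close>

lemma normal_cone_hull_point:
  assumes "finite V" and "x \<in> convex hull V"
  shows "\<exists>W. W \<subseteq> V \<and> W \<noteq> {} \<and> normal_cone I V {x} = normal_cone I V W"
proof -
  obtain u where u: "\<forall>v\<in>V. 0 \<le> u v" "sum u V = 1" "(\<Sum>v\<in>V. u v *\<^sub>R v) = x"
    using assms by (auto simp: convex_hull_finite)
  let ?W = "{v \<in> V. 0 < u v}"
  have "?W \<noteq> {}"
  proof
    assume "?W = {}"
    then have "sum u V = 0" using u(1) by (intro sum.neutral) force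
    then show False using u(2) by simp
  qed
  have px: "pairing I y x = (\<Sum>v\<in>V. u v * pairing I y v)" for y
    unfolding u(3)[symmetric]
    by (simp add: linear_sum[OF linear_pairing] linear_cmul[OF linear_pairing])
  have "(\<forall>z\<in>V. pairing I y z \<le> pairing I y x) \<longleftrightarrow>
      (\<forall>w\<in>?W. \<forall>z\<in>V. pairing I y z \<le> pairing I y w)" for y
  proof
    assume max: "\<forall>z\<in>V. pairing I y z \<le> pairing I y x"
    have "(\<Sum>v\<in>V. u v * (pairing I y x - pairing I y v)) = 0"
      by (simp add: right_diff_distrib sum_subtractf u(2) flip: px sum_distrib_right)
    moreover have "\<forall>v\<in>V. 0 \<le> u v * (pairing I y x - pairing I y v)"
      using max u(1) by simp
    ultimately have "\<forall>v\<in>V. u v * (pairing I y x - pairing I y v) = 0"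
      using sum_nonneg_eq_0_iff[OF assms(1), of "\<lambda>v. u v * (pairing I y x - pairing I y v)"]
      by simp
    then show "\<forall>w\<in>?W. \<forall>z\<in>V. pairing I y z \<le> pairing I y w"
      using max by force
  next
    assume max: "\<forall>w\<in>?W. \<forall>z\<in>V. pairing I y z \<le> pairing I y w"
    show "\<forall>z\<in>V. pairing I y z \<le> pairing I y x"
    proof
      fix z assume "z \<in> V"
      then have "u v * pairing I y z \<le> u v * pairing I y v" if "v \<in> V" for v
        using max u(1) that by (cases "u v = 0") (auto intro!: mult_left_mono simp: less_le)
      then have "(\<Sum>v\<in>V. u v * pairing I y z) \<le> pairing I y x"
        unfolding px by (rule sum_mono)
      then show "pairing I y z \<le> pairing I y x"
        by (simp add: u(2) flip: sum_distrib_right)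
    qed
  qed
  then have "normal_cone I V {x} = normal_cone I V ?W"
    unfolding normal_cone_def by simp
  with \<open>?W \<noteq> {}\<close> show ?thesis by (intro exI[of _ ?W]) simp
qed

text \<open>Nonemptiness matters: for empty \<open>A\<close> the left side is \<open>RR I\<close>,
  the right side is \<open>UNIV\<close>.\<close>

lemma normal_cone_UN:
  assumes "A \<noteq> {}"
  shows "normal_cone I P (\<Union>x\<in>A. W x) = (\<Inter>x\<in>A. normal_cone I P (W x))"
  using assms by (auto simp: normal_cone_def)

text \<open>Each point of \<open>W\<close> is replaced by generators with the same cone, chosen by
  \<open>normal_cone_hull_point\<close>. Their union has the same cone as \<open>W\<close>, since
  unions of point sets correspond to intersections of cones.\<close>

lemma normal_fan_convex_hull:
  assumes "finite V"
  shows "normal_fan I (convex hull V) = {normal_cone I V W |W. W \<subseteq> V \<and> W \<noteq> {}}"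
proof -
  have "\<exists>U. U \<subseteq> V \<and> U \<noteq> {} \<and> normal_cone I V W = normal_cone I V U"
    if W: "W \<subseteq> convex hull V" "W \<noteq> {}" for W
  proof -
    have "\<forall>x\<in>W. \<exists>U. U \<subseteq> V \<and> U \<noteq> {} \<and> normal_cone I V {x} = normal_cone I V U"
      using normal_cone_hull_point[OF assms] W by blast
    then obtain U where U: "\<And>x. x \<in> W \<Longrightarrow> U x \<subseteq> V \<and> U x \<noteq> {} \<and>
        normal_cone I V {x} = normal_cone I V (U x)"
      by metis
    have "normal_cone I V W = (\<Inter>x\<in>W. normal_cone I V {x})"
      using normal_cone_UN[OF W(2), of I V "\<lambda>x. {x}"] by simp
    also have "\<dots> = normal_cone I V (\<Union>x\<in>W. U x)"
      using U by (simp add: normal_cone_UN[OF W(2)])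
    finally have "normal_cone I V W = normal_cone I V (\<Union>x\<in>W. U x)" .
    moreover have "(\<Union>x\<in>W. U x) \<subseteq> V" by (rule UN_least) (simp add: U)
    moreover obtain w where "w \<in> W" using W(2) by auto
    then have "(\<Union>x\<in>W. U x) \<noteq> {}" using U[of w] by auto
    ultimately show ?thesis by (intro exI[of _ "\<Union>x\<in>W. U x"] conjI)
  qed
  moreover have "W \<subseteq> convex hull V" if "W \<subseteq> V" for W
    using that hull_subset[of V convex] by (rule order_trans)
  ultimately show ?thesis
    unfolding normal_fan_eq[OF convex_convex_hull] normal_cone_convex_hull
    by (intro equalityI subsetI) (smt (verit) mem_Collect_eq)+
qed

section \<open>Points are recognized by their fan\<close>

lemma polytopes_convex: "P \<in> polytopes I \<Longrightarrow> convex P"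
  by (simp add: polytopes_def polytope_imp_convex)

text \<open>If \<open>RR I\<close> is the only cone, every functional is constant on
  \<open>P\<close>. Testing \<open>x - z\<close> on two points \<open>x\<close> and \<open>z\<close>
  of \<open>P\<close> shows that their squared distance is at most 0.\<close>

lemma singleton_iff_normal_fan:
  assumes "finite I" and P: "P \<in> polytopes I"
  shows "(\<exists>p. P = {p}) \<longleftrightarrow> normal_fan I P = {RR I}"
proof
  assume "\<exists>p. P = {p}"
  then obtain p where p: "P = {p}" ..
  have "normal_cone I {p} {p} = RR I" by (simp add: normal_cone_def)
  moreover have "W \<subseteq> {p} \<and> W \<noteq> {} \<longleftrightarrow> W = {p}" for W by blast
  ultimately show "normal_fan I P = {RR I}"
    using normal_fan_eq[OF polytopes_convex[OF P]] p by simp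
next
  assume fan: "normal_fan I P = {RR I}"
  have cones: "normal_fan I P = {normal_cone I P W |W. W \<subseteq> P \<and> W \<noteq> {}}"
    by (rule normal_fan_eq[OF polytopes_convex[OF P]])
  have "RR I \<in> normal_fan I P" using fan by simp
  then obtain x where x: "x \<in> P" unfolding cones by auto
  then have "normal_cone I P P \<in> normal_fan I P" unfolding cones by auto
  then have cone: "normal_cone I P P = RR I" using fan by simp
  have "z = x" if z: "z \<in> P" for z
  proof -
    have RR: "x \<in> RR I" "z \<in> RR I" using P x z by (auto simp: polytopes_def)
    then have "x - z \<in> RR I" by (simp add: RR_def)
    then have "x - z \<in> normal_cone I P P" using cone by simp
    then have "pairing I (x - z) x \<le> pairing I (x - z) z"
      using x z unfolding normal_cone_def by blast
    then have "(\<Sum>i\<in>I. (x i - z i)\<^sup>2) \<le> 0"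
      by (simp add: power2_eq_square right_diff_distrib sum_subtractf pairing_def)
    moreover have "0 \<le> (\<Sum>i\<in>I. (x i - z i)\<^sup>2)" by (rule sum_nonneg) simp
    ultimately have "(\<Sum>i\<in>I. (x i - z i)\<^sup>2) = 0" by (rule antisym)
    then have "\<forall>i\<in>I. x i = z i"
      using assms(1) by (simp add: sum_nonneg_eq_0_iff)
    then have "x i = z i" for i using RR by (cases "i \<in> I") (auto simp: RR_def)
    then show "z = x" by (simp add: fun_eq_iff)
  qed
  then have "P = {x}" using x by blast
  then show "\<exists>p. P = {p}" by (rule exI[of _ x])
qed

section \<open>Orbits and the rearrangement inequality\<close>

text \<open>Equivalently \<open>(y i - y j) * (v i - v j)\<close> is never negative, so the relation
  is symmetric in \<open>y\<close> and \<open>v\<close>. For fixed \<open>v\<close> it amounts to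
  weak inequalities on \<open>y\<close>, as a closed cone requires.\<close>

definition comonotone :: "'a set \<Rightarrow> ('a \<Rightarrow> real) \<Rightarrow> ('a \<Rightarrow> real) \<Rightarrow> bool"
  where "comonotone I y v \<longleftrightarrow> (\<forall>i\<in>I. \<forall>j\<in>I. y j < y i \<longrightarrow> v j \<le> v i)"

text \<open>Inversion is a bijection of the permutation group, so dropping the inverse leaves the
  set unchanged and turns the action into plain composition.\<close>

definition orbit :: "'a set \<Rightarrow> ('a \<Rightarrow> real) \<Rightarrow> ('a \<Rightarrow> real) set"
  where "orbit I p = {p \<circ> \<sigma> |\<sigma>. \<sigma> permutes I}"

lemma orbit_polytope_eq: "orbit_polytope I p = convex hull orbit I p"
proof -
  have "(\<lambda>i. p (inv \<sigma> i)) \<in> orbit I p" if "\<sigma> permutes I" for \<sigma>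
    using permutes_inv[OF that] by (auto simp: orbit_def comp_def)
  moreover have "\<exists>\<tau>. p \<circ> \<sigma> = (\<lambda>i. p (inv \<tau> i)) \<and> \<tau> permutes I" if "\<sigma> permutes I" for \<sigma>
    using permutes_inv[OF that] permutes_inv_inv[OF that]
    by (intro exI[of _ "inv \<sigma>"]) (simp add: comp_def)
  ultimately have "{\<lambda>i. p (inv \<sigma> i) |\<sigma>. \<sigma> permutes I} = orbit I p"
    by (auto simp: orbit_def)
  then show ?thesis by (simp add: orbit_polytope_def)
qed

lemma finite_orbit: "finite I \<Longrightarrow> finite (orbit I p)"
  unfolding orbit_def using finite_permutations[of I] by simp

lemma self_in_orbit: "p \<in> orbit I p"
  unfolding orbit_def by (intro CollectI exI[of _ id]) (simp add: permutes_id)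

lemma orbit_comp:
  assumes "v \<in> orbit I p" and "\<tau> permutes I"
  shows "v \<circ> \<tau> \<in> orbit I p"
proof -
  obtain \<sigma> where "\<sigma> permutes I" "v = p \<circ> \<sigma>" using assms(1) by (auto simp: orbit_def)
  then show ?thesis
    unfolding orbit_def using permutes_compose[OF assms(2)] by (auto simp: comp_assoc)
qed

lemma orbit_trans:
  assumes "v \<in> orbit I p" and "w \<in> orbit I p"
  obtains \<tau> where "\<tau> permutes I" and "w = v \<circ> \<tau>"
proof -
  obtain \<sigma> \<rho> where *: "\<sigma> permutes I" "v = p \<circ> \<sigma>" "\<rho> permutes I" "w = p \<circ> \<rho>"
    using assms by (auto simp: orbit_def)
  have "v \<circ> (inv \<sigma> \<circ> \<rho>) = w"
    using * by (simp add: comp_assoc[symmetric] comp_assoc[of p \<sigma>] permutes_inv_o)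
  with * show ?thesis by (intro that[of "inv \<sigma> \<circ> \<rho>"]) (auto intro: permutes_compose permutes_inv)
qed

lemma orbit_subset_RR: "p \<in> RR I \<Longrightarrow> orbit I p \<subseteq> RR I"
  by (auto simp: orbit_def RR_def permutes_not_in)

lemma orbit_polytope_in_polytopes:
  assumes "finite I" and "p \<in> RR I"
  shows "orbit_polytope I p \<in> polytopes I"
  unfolding polytopes_def orbit_polytope_eq
  using finite_orbit[OF assms(1)] hull_minimal[of "orbit I p" "RR I" convex]
    orbit_subset_RR[OF assms(2)] convex_RR
  by (auto simp: polytope_def)

text \<open>An index maximizing both \<open>y\<close> and \<open>v\<close> can be made a fixed point
  of the permutation without decreasing the sum.\<close>

lemma rearrangement_inequality:
  assumes "finite I" and "comonotone I y v" and "\<tau> permutes I"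
  shows "pairing I y (v \<circ> \<tau>) \<le> pairing I y v"
  using assms
proof (induction "card I" arbitrary: I \<tau>)
  case 0
  then show ?case by (simp add: pairing_def)
next
  case (Suc n)
  then have "I \<noteq> {}" by auto
  \<comment> \<open>Comonotonicity constrains \<open>v\<close> only where \<open>y\<close> differs
    strictly. Ties at the top of \<open>y\<close> are therefore broken by maximizing
    \<open>v\<close> over \<open>A\<close>; the resulting \<open>i\<close> maximizes both on all of
    \<open>I\<close>.\<close>
  define A where "A = {i \<in> I. \<forall>j\<in>I. y j \<le> y i}"
  have "A \<noteq> {}"
    using Max_in[of "y ` I"] Max_ge[of "y ` I"] \<open>I \<noteq> {}\<close> Suc.prems(1) by (fastforce simp: A_def)
  moreover have "finite A" using Suc.prems(1) by (simp add: A_def)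
  ultimately obtain i where i: "i \<in> A" "\<And>j. j \<in> A \<Longrightarrow> v j \<le> v i"
    using Max_in[of "v ` A"] Max_ge[of "v ` A"] by (fastforce simp del: Max_in Max_ge)
  have iI: "i \<in> I" and ymax: "\<And>j. j \<in> I \<Longrightarrow> y j \<le> y i"
    using i(1) by (auto simp: A_def)
  have vmax: "v j \<le> v i" if "j \<in> I" for j
  proof (cases "y j < y i")
    case True
    then show ?thesis using Suc.prems(2) iI that by (auto simp: comonotone_def)
  next
    case False
    then have "j \<in> A" using that ymax by (fastforce simp: A_def)
    then show ?thesis by (rule i(2))
  qed
  define j where "j = inv \<tau> i"
  have j: "j \<in> I" "\<tau> j = i"
    using Suc.prems(3) iI permutes_inv[OF Suc.prems(3)]
    by (auto simp: j_def permutes_in_image permutes_inverses)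
  \<comment> \<open>As \<open>\<tau>\<close> sends \<open>j\<close> to \<open>i\<close>, swapping
    the two arguments makes \<open>i\<close> a fixed point. The pairing grows by
    \<open>(y i - y j) * (v i - v (\<tau> i))\<close>, which is nonnegative by the choice of
    \<open>i\<close>.\<close>
  define \<rho> where "\<rho> = \<tau> \<circ> Transposition.transpose i j"
  have \<rho>I: "\<rho> permutes I"
    unfolding \<rho>_def by (intro permutes_compose permutes_swap_id iI j Suc.prems(3))
  have \<rho>i: "\<rho> i = i" by (simp add: \<rho>_def j)
  have \<rho>: "\<rho> permutes (I - {i})"
    using \<rho>I \<rho>i by (auto simp: permutes_def)
  have "pairing I y (v \<circ> \<tau>) \<le> pairing I y (v \<circ> \<rho>)"
  proof (cases "i = j")
    case True
    then show ?thesis by (simp add: \<rho>_def)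
  next
    case False
    have split: "(\<Sum>k\<in>I. f k) = f i + (f j + (\<Sum>k\<in>I - {i} - {j}. f k))" for f :: "'a \<Rightarrow> real"
      using Suc.prems(1) iI j(1) False by (simp add: sum.remove[of _ i] sum.remove[of _ j])
    have "(\<Sum>k\<in>I - {i} - {j}. y k * v (\<tau> k)) = (\<Sum>k\<in>I - {i} - {j}. y k * v (\<rho> k))"
      by (intro sum.cong) (auto simp: \<rho>_def Transposition.transpose_def)
    moreover have "0 \<le> (y i - y j) * (v i - v (\<tau> i))"
      using ymax[OF j(1)] vmax[of "\<tau> i"] permutes_in_image[OF Suc.prems(3)] iI by simp
    moreover have "\<rho> j = \<tau> i" by (simp add: \<rho>_def)
    ultimately show ?thesis
      by (simp add: pairing_def split \<rho>i j(2)) (simp add: algebra_simps)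
  qed
  also have "\<dots> \<le> pairing I y v"
  proof -
    have "pairing (I - {i}) y (v \<circ> \<rho>) \<le> pairing (I - {i}) y v"
    proof (rule Suc.hyps(1))
      show "n = card (I - {i})" using Suc.hyps(2) iI Suc.prems(1) by simp
    qed (use Suc.prems \<rho> in \<open>auto simp: comonotone_def\<close>)
    then show ?thesis
      using Suc.prems(1) iI \<rho>i by (simp add: pairing_def sum.remove[of _ i])
  qed
  finally show ?case .
qed

text \<open>One direction is the rearrangement inequality. For the other, transpositions suffice:
  exchanging the entries of \<open>v\<close> at \<open>i\<close> and \<open>j\<close> changes the
  pairing by \<open>(y i - y j) * (v j - v i)\<close>, which maximality keeps from being
  positive.\<close>

lemma maximal_on_orbit_iff:
  assumes "finite I" and v: "v \<in> orbit I p"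
  shows "(\<forall>z\<in>orbit I p. pairing I y z \<le> pairing I y v) \<longleftrightarrow> comonotone I y v"
proof
  assume "comonotone I y v"
  then show "\<forall>z\<in>orbit I p. pairing I y z \<le> pairing I y v"
    using rearrangement_inequality[OF assms(1)] orbit_trans[OF v] by metis
next
  assume max: "\<forall>z\<in>orbit I p. pairing I y z \<le> pairing I y v"
  show "comonotone I y v"
    unfolding comonotone_def
  proof (intro ballI impI)
    fix i j assume i: "i \<in> I" and j: "j \<in> I" and less: "y j < y i"
    let ?w = "v \<circ> Transposition.transpose i j"
    have "pairing I y ?w \<le> pairing I y v"
      using max orbit_comp[OF v permutes_swap_id[OF i j]] by blast
    moreover have split: "(\<Sum>k\<in>I. f k) = f i + (f j + (\<Sum>k\<in>I - {i} - {j}. f k))"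
      for f :: "'a \<Rightarrow> real"
      using sum.remove[OF assms(1) i, of f] sum.remove[of "I - {i}" j f] assms(1) j less by auto
    moreover have "(\<Sum>k\<in>I - {i} - {j}. y k * ?w k) = (\<Sum>k\<in>I - {i} - {j}. y k * v k)"
      by (intro sum.cong) (auto simp: Transposition.transpose_def)
    ultimately have "(y i - y j) * (v j - v i) \<le> 0"
      by (simp add: pairing_def) (simp add: algebra_simps)
    then show "v j \<le> v i" using less by (simp add: mult_le_0_iff)
  qed
qed

lemma normal_cone_orbit:
  assumes "finite I" and "W \<subseteq> orbit I p"
  shows "normal_cone I (orbit I p) W = {y \<in> RR I. \<forall>v\<in>W. comonotone I y v}"
proof -
  have "(\<forall>x\<in>W. \<forall>z\<in>orbit I p. pairing I y z \<le> pairing I y x) \<longleftrightarrow>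
      (\<forall>v\<in>W. comonotone I y v)" for y
    using assms(2) by (intro ball_cong refl maximal_on_orbit_iff[OF assms(1)]) auto
  then show ?thesis by (simp add: normal_cone_def)
qed

lemma normal_fan_orbit:
  assumes "finite I"
  shows "normal_fan I (orbit_polytope I p) =
    {{y \<in> RR I. \<forall>v\<in>W. comonotone I y v} |W. W \<subseteq> orbit I p \<and> W \<noteq> {}}"
  unfolding orbit_polytope_eq normal_fan_convex_hull[OF finite_orbit[OF assms]]
  by (simp add: normal_cone_orbit[OF assms] cong: rev_conj_cong)

section \<open>The composition determines the fan of an orbit polytope\<close>

text \<open>Replace each coordinate by its rank, the position of its value among the distinct
  values. Equal compositions say that each rank occurs equally often in \<open>p\<close> and in
  \<open>q\<close>, so some permutation of the labels matches the ranks, and ranks retain the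
  order.\<close>

lemma composition_eq_imp_same_order:
  assumes "finite I" and eq: "composition_of I p = composition_of I q"
  obtains \<sigma> where "\<sigma> permutes I"
    and "\<And>i j. i \<in> I \<Longrightarrow> j \<in> I \<Longrightarrow> p i \<le> p j \<longleftrightarrow> q (\<sigma> i) \<le> q (\<sigma> j)"
proof -
  define xs where "xs r = sorted_list_of_set (r ` I)" for r :: "'a \<Rightarrow> real"
  have set_xs: "set (xs r) = r ` I" and sorted: "sorted_wrt (<) (xs r)" for r
    unfolding xs_def using assms(1) by (auto simp: strict_sorted_list_of_set)
  \<comment> \<open>\<open>composition_of\<close> lists values downwards; the common reversal
    cancels, so ranks can be counted upwards.\<close>
  have maps: "map (\<lambda>v. card {i \<in> I. p i = v}) (xs p) = map (\<lambda>v. card {i \<in> I. q i = v}) (xs q)"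
    using eq by (simp add: composition_of_def xs_def rev_map[symmetric])
  then have len: "length (xs p) = length (xs q)" by (rule map_eq_imp_length_eq)
  have "\<forall>r. \<forall>i\<in>I. \<exists>m<length (xs r). xs r ! m = r i"
    using set_xs by (metis image_eqI in_set_conv_nth)
  then obtain rank where rank: "\<And>r i. i \<in> I \<Longrightarrow> rank r i < length (xs r) \<and> xs r ! rank r i = r i"
    by metis
  have nth_less: "xs r ! k < xs r ! m \<longleftrightarrow> k < m"
    if "k < length (xs r)" "m < length (xs r)" for r k m
    using sorted_wrt_nth_less[OF sorted] that by (metis less_asym linorder_less_linear)
  have rank_le: "rank r i \<le> rank r j \<longleftrightarrow> r i \<le> r j" if "i \<in> I" "j \<in> I" for r i j
    using nth_less[of "rank r j" r "rank r i"] rank[of i r] rank[of j r] that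
    by (auto simp: not_less[symmetric])
  have rank_eq: "rank r i = m \<longleftrightarrow> r i = xs r ! m" if "i \<in> I" "m < length (xs r)" for r i m
    using nth_less[of m r "rank r i"] nth_less[of "rank r i" r m] rank[of i r] that
    by (metis less_irrefl linorder_less_linear)
  have "card {i \<in> I. rank p i = m} = card {i \<in> I. rank q i = m}" for m
  proof (cases "m < length (xs p)")
    case True
    have "{i \<in> I. rank p i = m} = {i \<in> I. p i = xs p ! m}"
      "{i \<in> I. rank q i = m} = {i \<in> I. q i = xs q ! m}"
      by (intro Collect_cong conj_cong refl rank_eq; use True len in simp)+
    moreover have "card {i \<in> I. p i = xs p ! m} = card {i \<in> I. q i = xs q ! m}"
      using arg_cong[OF maps, of "\<lambda>l. l ! m"] True len by simp
    ultimately show ?thesis by simp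
  next
    case False
    have "rank p i < length (xs p)" "rank q i < length (xs p)" if "i \<in> I" for i
      using rank[OF that, of p] rank[OF that, of q] len by simp_all
    with False have "{i \<in> I. rank p i = m} = {}" "{i \<in> I. rank q i = m} = {}"
      by blast+
    then show ?thesis by (simp only:)
  qed
  then have "image_mset (rank p) (mset_set I) = image_mset (rank q) (mset_set I)"
    using assms(1)
    by (intro multiset_eqI) (simp add: count_image_mset' conj_commute eq_commute)
  then obtain \<sigma> where \<sigma>: "\<sigma> permutes I" "\<forall>i\<in>I. rank p i = rank q (\<sigma> i)"
    using image_mset_eq_implies_permutes[OF assms(1)] by blast
  show ?thesis
  proof (rule that[OF \<sigma>(1)])
    fix i j assume "i \<in> I" "j \<in> I"
    then show "p i \<le> p j \<longleftrightarrow> q (\<sigma> i) \<le> q (\<sigma> j)"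
      using rank_le \<sigma> by (metis permutes_in_image)
  qed
qed

text \<open>Comonotonicity sees only the order of the coordinates, so it is unchanged when
  \<open>p \<circ> \<tau>\<close> is exchanged for
  \<open>q \<circ> (\<sigma> \<circ> \<tau>)\<close>. The reverse inclusion follows by swapping
  \<open>p\<close> and \<open>q\<close>.\<close>

lemma normal_fan_orbit_mono:
  assumes "finite I" and eq: "composition_of I p = composition_of I q"
  shows "normal_fan I (orbit_polytope I p) \<subseteq> normal_fan I (orbit_polytope I q)"
proof
  fix N assume "N \<in> normal_fan I (orbit_polytope I p)"
  then obtain W where W: "W \<subseteq> orbit I p" "W \<noteq> {}"
    and N: "N = {y \<in> RR I. \<forall>v\<in>W. comonotone I y v}"
    unfolding normal_fan_orbit[OF assms(1)] by blast
  obtain \<sigma> where \<sigma>: "\<sigma> permutes I"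
    and ord: "\<And>i j. i \<in> I \<Longrightarrow> j \<in> I \<Longrightarrow> p i \<le> p j \<longleftrightarrow> q (\<sigma> i) \<le> q (\<sigma> j)"
    using composition_eq_imp_same_order[OF assms] by blast
  \<comment> \<open>The transfer from the orbit of \<open>p\<close> to that of \<open>q\<close> is
    made on permutations, where it is left composition with \<open>\<sigma>\<close>.\<close>
  define T where "T = {\<tau>. \<tau> permutes I \<and> p \<circ> \<tau> \<in> W}"
  have WT: "W = (\<lambda>\<tau>. p \<circ> \<tau>) ` T" using W(1) by (auto simp: T_def orbit_def)
  let ?W = "(\<lambda>\<tau>. q \<circ> (\<sigma> \<circ> \<tau>)) ` T"
  have "comonotone I y (p \<circ> \<tau>) \<longleftrightarrow> comonotone I y (q \<circ> (\<sigma> \<circ> \<tau>))" if "\<tau> \<in> T" for y \<tau>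
    using ord that by (auto simp: comonotone_def T_def permutes_in_image)
  then have "N = {y \<in> RR I. \<forall>v\<in>?W. comonotone I y v}"
    unfolding N WT by auto
  moreover have "q \<circ> (\<sigma> \<circ> \<tau>) \<in> orbit I q" if "\<tau> \<in> T" for \<tau>
    using that permutes_compose[OF _ \<sigma>, of \<tau>] unfolding orbit_def T_def by blast
  then have "?W \<subseteq> orbit I q" by (rule image_subsetI)
  moreover have "?W \<noteq> {}" using W(2) WT by simp
  ultimately show "N \<in> normal_fan I (orbit_polytope I q)"
    unfolding normal_fan_orbit[OF assms(1)] by (intro CollectI exI[of _ ?W] conjI)
qed

lemma orbit_polytopes_normal_equiv:
  assumes "finite I" "p \<in> RR I" "q \<in> RR I" "composition_of I p = composition_of I q"
  shows "(orbit_polytope I p, orbit_polytope I q) \<in> normal_equiv I"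
  using assms normal_fan_orbit_mono[of I p q] normal_fan_orbit_mono[of I q p]
  by (auto simp: normal_equiv_def orbit_polytope_in_polytopes)

section \<open>One-part compositions, and realization of all compositions\<close>

text \<open>If the orbit is a point, invariance under transpositions makes all coordinates equal.
  For empty \<open>I\<close> the orbit polytope is a point although \<open>p\<close> takes no value
  on \<open>I\<close>, which is why \<open>I\<close> must be nonempty.\<close>

lemma orbit_polytope_singleton_iff:
  assumes "finite I" and "I \<noteq> {}"
  shows "(\<exists>x. orbit_polytope I p = {x}) \<longleftrightarrow> card (p ` I) = 1"
proof
  assume "\<exists>x. orbit_polytope I p = {x}"
  then obtain x where "orbit_polytope I p = {x}" ..
  then have x: "v = x" if "v \<in> orbit I p" for v
    using that hull_subset[of "orbit I p" convex] by (auto simp: orbit_polytope_eq)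
  have "p i = p j" if "i \<in> I" "j \<in> I" for i j
  proof -
    have "p \<circ> Transposition.transpose i j = p"
      using x[OF orbit_comp[OF self_in_orbit permutes_swap_id[OF that]]] x[OF self_in_orbit]
      by metis
    then show ?thesis by (metis comp_apply transpose_apply_second)
  qed
  then obtain i where "i \<in> I" "p ` I = {p i}" using assms(2) by blast
  then show "card (p ` I) = 1" by simp
next
  assume "card (p ` I) = 1"
  then obtain c where c: "p ` I = {c}" by (auto simp: card_1_singleton_iff)
  have "p \<circ> \<sigma> = p" if \<sigma>: "\<sigma> permutes I" for \<sigma>
  proof
    fix i show "(p \<circ> \<sigma>) i = p i"
    proof (cases "i \<in> I")
      case True
      then have "\<sigma> i \<in> I" using \<sigma> by (simp add: permutes_in_image)
      with True c have "p (\<sigma> i) = c" "p i = c" by blast+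
      then show ?thesis by simp
    qed (simp add: permutes_not_in[OF \<sigma>])
  qed
  then have "orbit I p = {p}" using self_in_orbit[of p I] by (fastforce simp: orbit_def)
  then show "\<exists>x. orbit_polytope I p = {x}" by (simp add: orbit_polytope_eq)
qed

lemma length_composition_of: "length (composition_of I p) = card (p ` I)"
  by (simp add: composition_of_def)

lemma is_composition_composition_of:
  assumes "finite I"
  shows "is_composition (composition_of I p) (card I)"
proof -
  have "sum_list (composition_of I p) = (\<Sum>v\<in>p ` I. card {i \<in> I. p i = v})"
    using assms
    by (simp add: composition_of_def sum_list_distinct_conv_sum_set)
  also have "\<dots> = card I"
    using sum.image_gen[OF assms, of "\<lambda>_. 1 :: nat" p] by simp
  finally have "sum_list (composition_of I p) = card I" .
  moreover have "0 < a" if "a \<in> set (composition_of I p)" for a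
    using that assms by (auto simp: composition_of_def card_gt_0_iff)
  ultimately show ?thesis by (simp add: is_composition_def)
qed

lemma sorted_list_of_set_insert_greater:
  assumes "finite A" and "\<And>a. a \<in> A \<Longrightarrow> a < m"
  shows "sorted_list_of_set (insert m A) = sorted_list_of_set A @ [m]"
proof (rule sorted_list_of_set_unique[THEN iffD1])
  show "sorted_wrt (<) (sorted_list_of_set A @ [m]) \<and>
      set (sorted_list_of_set A @ [m]) = insert m A \<and>
      length (sorted_list_of_set A @ [m]) = card (insert m A)"
    using assms by (auto simp: sorted_wrt_append strict_sorted_list_of_set card_insert_if)
qed (use assms in auto)

text \<open>Compositions start with the multiplicity of the largest value. So set aside
  \<open>a\<close> labels for the first part, realize the remaining parts on the other labels, and
  give the chosen labels a value above all others.\<close>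

lemma ex_composition_of:
  assumes "finite I" and "is_composition \<alpha> (card I)"
  shows "\<exists>p\<in>RR I. composition_of I p = \<alpha>"
  using assms
proof (induction \<alpha> arbitrary: I)
  case Nil
  then have "I = {}" by (simp add: is_composition_def)
  then have "0 \<in> RR I" "composition_of I 0 = []"
    by (auto simp: RR_def composition_of_def)
  then show ?case by blast
next
  case (Cons a \<alpha>)
  then have a: "0 < a" "card I = a + sum_list \<alpha>" by (auto simp: is_composition_def)
  then obtain A where A: "A \<subseteq> I" "card A = a"
    using obtain_subset_with_card_n[of a I] by auto
  then have "finite A" using Cons.prems(1) finite_subset by blast
  have "is_composition \<alpha> (card (I - A))"
    using Cons.prems A a \<open>finite A\<close> by (auto simp: is_composition_def card_Diff_subset)
  then obtain p where p: "p \<in> RR (I - A)" "composition_of (I - A) p = \<alpha>"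
    using Cons.IH[of "I - A"] Cons.prems(1) by auto
  \<comment> \<open>The strict bound keeps the new block apart from the old values, whose
    multiplicities stay the same.\<close>
  obtain m where m: "\<And>x. x \<in> p ` (I - A) \<Longrightarrow> x < m"
    using finite_subset[of "p ` (I - A)"] Cons.prems(1)
    by (metis Max_ge finite_Diff finite_imageI le_less_trans less_add_one)
  let ?q = "\<lambda>i. if i \<in> A then m else p i"
  have "A \<noteq> {}" using A a by auto
  then have img: "?q ` I = insert m (p ` (I - A))"
    using A(1) by auto
  have "p i \<noteq> m" if "i \<in> I" "i \<notin> A" for i using m[of "p i"] that by auto
  then have cm: "{i \<in> I. ?q i = m} = A" using A(1) by auto
  have cv: "{i \<in> I. ?q i = v} = {i \<in> I - A. p i = v}" if "v \<in> p ` (I - A)" for v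
    using m[OF that] by auto
  define L where "L = sorted_list_of_set (p ` (I - A))"
  have L: "set L = p ` (I - A)" using Cons.prems(1) by (simp add: L_def)
  have "sorted_list_of_set (?q ` I) = L @ [m]"
    unfolding img L_def
    by (rule sorted_list_of_set_insert_greater) (use Cons.prems(1) m in auto)
  then have "composition_of I ?q =
      card {i \<in> I. ?q i = m} # map (\<lambda>v. card {i \<in> I. ?q i = v}) (rev L)"
    unfolding composition_of_def by (simp only: rev_append rev.simps append_Nil append_Cons list.map)
  also have "\<dots> = a # map (\<lambda>v. card {i \<in> I - A. p i = v}) (rev L)"
    unfolding cm A(2) using cv L by (intro arg_cong2[of _ _ _ _ "(#)"] map_cong refl) simp_all
  also have "\<dots> = a # composition_of (I - A) p"
    by (simp only: composition_of_def L_def)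
  finally have "composition_of I ?q = a # composition_of (I - A) p" .
  moreover have "?q \<in> RR I" using p(1) A(1) by (auto simp: RR_def)
  ultimately show ?case using p(2) by blast
qed

section \<open>Products of polytopes and their fans\<close>

definition restrict_vec :: "'a set \<Rightarrow> ('a \<Rightarrow> real) \<Rightarrow> ('a \<Rightarrow> real)"
  where "restrict_vec S y = (\<lambda>i. if i \<in> S then y i else 0)"

text \<open>The product of a cone \<open>A\<close> in \<open>RR S\<close> and a cone
  \<open>B\<close> in \<open>RR T\<close> for disjoint label sets, described by projections because
  pairs are encoded as sums.\<close>

definition join_cone ::
    "'a set \<Rightarrow> 'a set \<Rightarrow> ('a \<Rightarrow> real) set \<Rightarrow> ('a \<Rightarrow> real) set \<Rightarrow> ('a \<Rightarrow> real) set"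
  where "join_cone S T A B = {y \<in> RR (S \<union> T). restrict_vec S y \<in> A \<and> restrict_vec T y \<in> B}"

lemma restrict_vec_in_RR: "restrict_vec S y \<in> RR S"
  by (simp add: restrict_vec_def RR_def)

lemma pairing_restrict_vec: "pairing S (restrict_vec S y) p = pairing S y p"
  by (simp add: pairing_def restrict_vec_def)

lemma restrict_vec_add:
  assumes "S \<inter> T = {}" "P \<subseteq> RR S" "Q \<subseteq> RR T" "p \<in> P" "q \<in> Q"
  shows "restrict_vec S (p + q) = p" and "restrict_vec T (p + q) = q"
  using subsetD[OF assms(2,4)] subsetD[OF assms(3,5)] assms(1)
  by (auto simp: restrict_vec_def RR_def fun_eq_iff)

lemma pairing_superset:
  assumes "finite T" "S \<subseteq> T" "p \<in> RR S"
  shows "pairing T y p = pairing S y p"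
  unfolding pairing_def by (rule sum.mono_neutral_right) (use assms in \<open>auto simp: RR_def\<close>)

lemma pairing_add_disjoint:
  assumes "finite S" "finite T" "p \<in> RR S" "q \<in> RR T"
  shows "pairing (S \<union> T) y (p + q) = pairing S y p + pairing T y q"
  using assms
  by (simp add: linear_add[OF linear_pairing] pairing_superset[of "S \<union> T" S] pairing_superset[of "S \<union> T" T])

text \<open>With vectors extended by zero the product is a Minkowski sum, which gives access to the
  general facts on associativity and on hulls of sums.\<close>

lemma polytope_mult_eq: "polytope_mult P Q = P + Q"
  by (auto simp: polytope_mult_def set_plus_def)

lemma polytope_multI: "p \<in> P \<Longrightarrow> q \<in> Q \<Longrightarrow> p + q \<in> polytope_mult P Q"
  by (auto simp: polytope_mult_def)

lemma polytope_multE: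
  assumes "x \<in> polytope_mult P Q"
  obtains p q where "p \<in> P" "q \<in> Q" "x = p + q"
  using assms by (auto simp: polytope_mult_def)

lemma polytope_mult_assoc:
  "polytope_mult (polytope_mult P Q) R = polytope_mult P (polytope_mult Q R)"
  by (simp add: polytope_mult_eq add.assoc)

lemma polytope_mult_zero: "polytope_mult P {0} = P" "polytope_mult {0} P = P"
  by (simp_all add: polytope_mult_def)

lemma polytope_mult_in_polytopes:
  assumes "P \<in> polytopes S" "Q \<in> polytopes T"
  shows "polytope_mult P Q \<in> polytopes (S \<union> T)"
proof -
  obtain V W where "finite V" "P = convex hull V" "finite W" "Q = convex hull W"
    using assms by (auto simp: polytopes_def polytope_def)
  then have "polytope (polytope_mult P Q)"
    unfolding polytope_mult_eq polytope_def
    by (intro exI[of _ "V + W"] conjI finite_set_plus) (simp_all add: convex_hull_set_plus)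
  moreover have "polytope_mult P Q \<subseteq> RR (S \<union> T)"
  proof
    fix x assume "x \<in> polytope_mult P Q"
    then obtain p q where x: "p \<in> P" "q \<in> Q" "x = p + q" by (rule polytope_multE)
    then have "p \<in> RR (S \<union> T)" "q \<in> RR (S \<union> T)"
      using assms RR_mono[of S "S \<union> T"] RR_mono[of T "S \<union> T"] by (auto simp: polytopes_def)
    then show "x \<in> RR (S \<union> T)" unfolding x(3) by (rule RR_add)
  qed
  ultimately show ?thesis by (simp add: polytopes_def)
qed

text \<open>The pairing with \<open>p + q\<close> is a sum of one term per factor. Freezing one
  summand while varying the other separates the two maximization problems.\<close>

lemma maximal_mult_iff:
  assumes "finite S" "finite T" "P \<subseteq> RR S" "Q \<subseteq> RR T" "p \<in> P" "q \<in> Q"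
  shows "(\<forall>z\<in>polytope_mult P Q. pairing (S \<union> T) y z \<le> pairing (S \<union> T) y (p + q)) \<longleftrightarrow>
    (\<forall>z\<in>P. pairing S y z \<le> pairing S y p) \<and> (\<forall>z\<in>Q. pairing T y z \<le> pairing T y q)"
    (is "?L \<longleftrightarrow> ?R1 \<and> ?R2")
proof (intro iffI conjI)
  have sum: "pairing (S \<union> T) y (a + b) = pairing S y a + pairing T y b" if "a \<in> P" "b \<in> Q" for a b
    using that assms by (intro pairing_add_disjoint) auto
  {
    assume L: ?L
    show ?R1
    proof
      fix z assume z: "z \<in> P"
      have "pairing (S \<union> T) y (z + q) \<le> pairing (S \<union> T) y (p + q)"
        using L polytope_multI[OF z assms(6)] by (rule bspec)
      then show "pairing S y z \<le> pairing S y p" using sum z assms(5,6) by simp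
    qed
    show ?R2
    proof
      fix z assume z: "z \<in> Q"
      have "pairing (S \<union> T) y (p + z) \<le> pairing (S \<union> T) y (p + q)"
        using L polytope_multI[OF assms(5) z] by (rule bspec)
      then show "pairing T y z \<le> pairing T y q" using sum z assms(5,6) by simp
    qed
  next
    assume R: "?R1 \<and> ?R2"
    show ?L
    proof
      fix z assume "z \<in> polytope_mult P Q"
      then obtain a b where z: "a \<in> P" "b \<in> Q" "z = a + b" by (rule polytope_multE)
      then show "pairing (S \<union> T) y z \<le> pairing (S \<union> T) y (p + q)"
        using R sum assms(5,6) by (simp add: add_mono)
    qed
  }
qed

text \<open>Maximality at a point is a condition on each of its two components separately, so
  \<open>W\<close> enters only through its projections even when it is not itself a product.\<close>

lemma normal_cone_mult:
  assumes "finite S" "finite T" "S \<inter> T = {}" "P \<subseteq> RR S" "Q \<subseteq> RR T" "W \<subseteq> polytope_mult P Q"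
  shows "normal_cone (S \<union> T) (polytope_mult P Q) W =
    join_cone S T (normal_cone S P (restrict_vec S ` W)) (normal_cone T Q (restrict_vec T ` W))"
proof -
  have "(\<forall>z\<in>polytope_mult P Q. pairing (S \<union> T) y z \<le> pairing (S \<union> T) y w) \<longleftrightarrow>
    (\<forall>z\<in>P. pairing S y z \<le> pairing S y (restrict_vec S w)) \<and>
    (\<forall>z\<in>Q. pairing T y z \<le> pairing T y (restrict_vec T w))" if "w \<in> W" for w y
  proof -
    have "w \<in> polytope_mult P Q" using assms(6) that by (rule subsetD)
    then obtain p q where w: "p \<in> P" "q \<in> Q" "w = p + q" by (rule polytope_multE)
    then have "restrict_vec S w = p" "restrict_vec T w = q"
      using restrict_vec_add[OF assms(3-5) w(1,2)] by simp_all
    then show ?thesis using maximal_mult_iff[OF assms(1,2,4,5) w(1,2)] w(3) by simp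
  qed
  then show ?thesis
    unfolding normal_cone_def join_cone_def
    by (simp add: pairing_restrict_vec restrict_vec_in_RR ball_conj_distrib)
qed

lemma normal_fan_mult:
  assumes "finite S" "finite T" "S \<inter> T = {}" and P: "P \<in> polytopes S" and Q: "Q \<in> polytopes T"
  shows "normal_fan (S \<union> T) (polytope_mult P Q) =
    {join_cone S T A B |A B. A \<in> normal_fan S P \<and> B \<in> normal_fan T Q}" (is "?L = ?R")
proof
  have sub: "P \<subseteq> RR S" "Q \<subseteq> RR T" using P Q by (auto simp: polytopes_def)
  note cone = normal_cone_mult[OF assms(1-3) sub]
  have fanP: "normal_fan S P = {normal_cone S P W |W. W \<subseteq> P \<and> W \<noteq> {}}"
    and fanQ: "normal_fan T Q = {normal_cone T Q W |W. W \<subseteq> Q \<and> W \<noteq> {}}"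
    and fan: "?L = {normal_cone (S \<union> T) (polytope_mult P Q) W |W. W \<subseteq> polytope_mult P Q \<and> W \<noteq> {}}"
    using polytopes_convex[OF polytope_mult_in_polytopes[OF P Q]] polytopes_convex[OF P]
      polytopes_convex[OF Q] by (simp_all add: normal_fan_eq)
  show "?L \<subseteq> ?R"
  proof
    fix N assume "N \<in> ?L"
    then obtain W where W: "W \<subseteq> polytope_mult P Q" "W \<noteq> {}"
      and N: "N = normal_cone (S \<union> T) (polytope_mult P Q) W"
      unfolding fan by blast
    have r: "restrict_vec S w \<in> P \<and> restrict_vec T w \<in> Q" if "w \<in> W" for w
    proof -
      have "w \<in> polytope_mult P Q" using W(1) that by (rule subsetD)
      then obtain p q where w: "p \<in> P" "q \<in> Q" "w = p + q" by (rule polytope_multE)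
      then show ?thesis
        using restrict_vec_add[OF assms(3) sub w(1,2)] by simp
    qed
    have "normal_cone S P (restrict_vec S ` W) \<in> normal_fan S P"
      unfolding fanP using r W(2)
      by (intro CollectI exI[of _ "restrict_vec S ` W"] conjI refl image_subsetI) auto
    moreover have "normal_cone T Q (restrict_vec T ` W) \<in> normal_fan T Q"
      unfolding fanQ using r W(2)
      by (intro CollectI exI[of _ "restrict_vec T ` W"] conjI refl image_subsetI) auto
    ultimately show "N \<in> ?R"
      unfolding N cone[OF W(1)]
      by (intro CollectI exI[of _ "normal_cone S P (restrict_vec S ` W)"]
          exI[of _ "normal_cone T Q (restrict_vec T ` W)"] conjI refl)
  qed
  show "?R \<subseteq> ?L"
  proof
    fix N assume "N \<in> ?R"
    then obtain U V where U: "U \<subseteq> P" "U \<noteq> {}" and V: "V \<subseteq> Q" "V \<noteq> {}"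
      and N: "N = join_cone S T (normal_cone S P U) (normal_cone T Q V)"
      unfolding fanP fanQ by auto
    \<comment> \<open>Given a point set in each factor, their product projects back onto both.
      Surjectivity of each projection uses a point \<open>v0\<close> or \<open>u0\<close> of the
      other set.\<close>
    let ?W = "polytope_mult U V"
    have W: "?W \<subseteq> polytope_mult P Q"
      unfolding polytope_mult_eq using U(1) V(1) by (rule set_plus_mono2)
    have r: "restrict_vec S (u + v) = u" "restrict_vec T (u + v) = v" if "u \<in> U" "v \<in> V" for u v
      using restrict_vec_add[OF assms(3) sub subsetD[OF U(1)] subsetD[OF V(1)]] that by simp_all
    obtain u0 v0 where u0: "u0 \<in> U" and v0: "v0 \<in> V" using U(2) V(2) by auto
    have "restrict_vec S ` ?W = U"
    proof
      show "restrict_vec S ` ?W \<subseteq> U"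
        by (rule image_subsetI) (metis polytope_multE r(1))
      show "U \<subseteq> restrict_vec S ` ?W"
      proof
        fix u assume u: "u \<in> U"
        show "u \<in> restrict_vec S ` ?W"
          by (rule image_eqI[of _ _ "u + v0"]) (simp_all add: r u v0 polytope_multI)
      qed
    qed
    moreover have "restrict_vec T ` ?W = V"
    proof
      show "restrict_vec T ` ?W \<subseteq> V"
        by (rule image_subsetI) (metis polytope_multE r(2))
      show "V \<subseteq> restrict_vec T ` ?W"
      proof
        fix v assume v: "v \<in> V"
        show "v \<in> restrict_vec T ` ?W"
          by (rule image_eqI[of _ _ "u0 + v"]) (simp_all add: r u0 v polytope_multI)
      qed
    qed
    ultimately have "N = normal_cone (S \<union> T) (polytope_mult P Q) ?W"
      unfolding N cone[OF W] by simp
    moreover have "?W \<noteq> {}" using polytope_multI[OF u0 v0] by auto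
    ultimately show "N \<in> ?L"
      unfolding fan using W by (intro CollectI exI[of _ ?W] conjI)
  qed
qed

lemma normal_equiv_mult:
  assumes "finite S" "finite T" "S \<inter> T = {}"
    and "(P, P') \<in> normal_equiv S" "(Q, Q') \<in> normal_equiv T"
  shows "(polytope_mult P Q, polytope_mult P' Q') \<in> normal_equiv (S \<union> T)"
  using assms by (simp add: normal_equiv_def polytope_mult_in_polytopes normal_fan_mult)

text \<open>Left to right, \<open>normal_equiv_mult\<close> and transitivity reduce any choice of
  members to \<open>P\<close> and \<open>Q\<close>. The converse uses that \<open>P\<close> and
  \<open>Q\<close> belong to their own classes, as \<open>normal_equiv\<close> is reflexive on
  polytopes.\<close>

lemma class_mult_classes:
  assumes "finite S" "finite T" "S \<inter> T = {}" and P: "P \<in> polytopes S" and Q: "Q \<in> polytopes T"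
  shows "class_mult S T (normal_equiv S `` {P}) (normal_equiv T `` {Q}) =
    normal_equiv (S \<union> T) `` {polytope_mult P Q}" (is "?L = ?R")
proof
  show "?L \<subseteq> ?R"
  proof
    fix R assume "R \<in> ?L"
    then obtain P' Q' where "(P, P') \<in> normal_equiv S" "(Q, Q') \<in> normal_equiv T"
      and R: "(polytope_mult P' Q', R) \<in> normal_equiv (S \<union> T)"
      unfolding class_mult_def by auto
    then have "(polytope_mult P Q, polytope_mult P' Q') \<in> normal_equiv (S \<union> T)"
      using normal_equiv_mult[OF assms(1-3)] by blast
    then have "(polytope_mult P Q, R) \<in> normal_equiv (S \<union> T)"
      using R by (simp add: normal_equiv_def)
    then show "R \<in> ?R" by simp
  qed
  have "(P, P) \<in> normal_equiv S" "(Q, Q) \<in> normal_equiv T"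
    using P Q by (simp_all add: normal_equiv_def)
  then show "?R \<subseteq> ?L"
    unfolding class_mult_def by (intro Image_mono subset_refl) auto
qed

lemma polytope_mult_singleton_iff:
  assumes "S \<inter> T = {}" "P \<subseteq> RR S" "Q \<subseteq> RR T" "P \<noteq> {}" "Q \<noteq> {}"
  shows "(\<exists>x. polytope_mult P Q = {x}) \<longleftrightarrow> (\<exists>p. P = {p}) \<and> (\<exists>q. Q = {q})"
proof
  assume "(\<exists>p. P = {p}) \<and> (\<exists>q. Q = {q})"
  then obtain p q where "P = {p}" "Q = {q}" by auto
  then have "polytope_mult P Q = {p + q}" by (simp add: polytope_mult_def)
  then show "\<exists>x. polytope_mult P Q = {x}" by (rule exI[of _ "p + q"])
next
  assume "\<exists>x. polytope_mult P Q = {x}"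
  then obtain x where x: "polytope_mult P Q = {x}" by auto
  \<comment> \<open>Every pair of members sums to \<open>x\<close>, and disjointness of the labels
    lets both summands be recovered from \<open>x\<close>.\<close>
  have "P = {restrict_vec S x} \<and> Q = {restrict_vec T x}"
  proof -
    have r: "a = restrict_vec S x \<and> b = restrict_vec T x" if "a \<in> P" "b \<in> Q" for a b
    proof -
      have "a + b = x" using polytope_multI[OF that] x by simp
      then show ?thesis using restrict_vec_add[OF assms(1-3) that] by simp
    qed
    obtain p0 q0 where "p0 \<in> P" "q0 \<in> Q" using assms(4,5) by auto
    then show ?thesis using r by (metis insertI1 insert_absorb is_singletonI' is_singleton_the_elem singletonD)
  qed
  then show "(\<exists>p. P = {p}) \<and> (\<exists>q. Q = {q})"
    by (intro conjI exI[of _ "restrict_vec S x"] exI[of _ "restrict_vec T x"]) simp_all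
qed

section \<open>Finite products of orbit polytopes\<close>

lemma orbit_product_finite: "orbit_product I P \<Longrightarrow> finite I"
  by (induction rule: orbit_product.induct) auto

lemma orbit_product_in_polytopes: "orbit_product I P \<Longrightarrow> P \<in> polytopes I"
proof (induction rule: orbit_product.induct)
  case empty
  then show ?case by (simp add: polytopes_def RR_def polytope_sing)
next
  case (mult S P T q)
  then show ?case by (intro polytope_mult_in_polytopes orbit_polytope_in_polytopes)
qed

lemma self_in_orbit_polytope: "p \<in> orbit_polytope I p"
  unfolding orbit_polytope_eq by (rule hull_inc[OF self_in_orbit])

lemma orbit_product_nonempty: "orbit_product I P \<Longrightarrow> P \<noteq> {}"
proof (induction rule: orbit_product.induct)
  case (mult S P T q)
  then obtain p where "p \<in> P" by auto
  from polytope_multI[OF this self_in_orbit_polytope[of q T]] show ?case by auto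
qed simp

lemma orbit_product_orbit_polytope:
  assumes "finite T" "q \<in> RR T"
  shows "orbit_product T (orbit_polytope T q)"
  using orbit_product.mult[OF orbit_product.empty assms(1) _ assms(2)]
  by (simp add: polytope_mult_zero)

text \<open>\<open>orbit_product\<close> appends one factor at a time on the right, so the induction
  runs over the right-hand product \<open>Q\<close> and regroups by associativity.\<close>

lemma orbit_product_mult:
  assumes "orbit_product T Q" "orbit_product S P" "S \<inter> T = {}"
  shows "orbit_product (S \<union> T) (polytope_mult P Q)"
  using assms
proof (induction rule: orbit_product.induct)
  case empty
  then show ?case by (simp add: polytope_mult_zero)
next
  case (mult T Q U q)
  then have "orbit_product (S \<union> T \<union> U) (polytope_mult (polytope_mult P Q) (orbit_polytope U q))"
    by (intro orbit_product.mult mult.IH) auto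
  then show ?case by (simp add: polytope_mult_assoc Un_assoc)
qed

section \<open>Relabeling along bijections\<close>

lemma relabel_in_RR: "relabel f I J p \<in> RR J"
  by (simp add: relabel_def RR_def)

lemma relabel_apply:
  assumes "bij_betw f I J" "i \<in> I"
  shows "relabel f I J p (f i) = p i"
  using assms bij_betw_apply[OF assms]
  by (simp add: relabel_def inv_into_f_f[OF bij_betw_imp_inj_on])

lemma relabel_eqI:
  assumes "bij_betw f I J" "p \<in> RR I" "q \<in> RR J" "\<And>i. i \<in> I \<Longrightarrow> q (f i) = p i"
  shows "relabel f I J p = q"
proof
  fix j show "relabel f I J p j = q j"
  proof (cases "j \<in> J")
    case True
    then obtain i where "i \<in> I" "j = f i" using assms(1) by (auto simp: bij_betw_def)
    then show ?thesis using relabel_apply[OF assms(1)] assms(4) by simp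
  next
    case False
    then show ?thesis using assms(3) by (simp add: relabel_def RR_def)
  qed
qed

lemma relabel_inverse:
  assumes "bij_betw f I J"
  shows "p \<in> RR I \<Longrightarrow> relabel (inv_into I f) J I (relabel f I J p) = p"
    and "q \<in> RR J \<Longrightarrow> relabel f I J (relabel (inv_into I f) J I q) = q"
proof -
  have g: "bij_betw (inv_into I f) J I" using assms by (rule bij_betw_inv_into)
  show "relabel (inv_into I f) J I (relabel f I J p) = p" if p: "p \<in> RR I"
    by (rule relabel_eqI[OF g relabel_in_RR p]) (simp add: relabel_def)
  show "relabel f I J (relabel (inv_into I f) J I q) = q" if q: "q \<in> RR J"
  proof (rule relabel_eqI[OF assms relabel_in_RR q])
    fix i assume "i \<in> I"
    then show "q (f i) = relabel (inv_into I f) J I q i"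
      by (simp add: relabel_def inv_into_inv_into_eq[OF assms])
  qed
qed

lemma relabel_image_inverse:
  assumes "bij_betw f I J" "Q \<subseteq> RR J"
  shows "relabel f I J ` relabel (inv_into I f) J I ` Q = Q"
proof -
  have "(\<lambda>q. relabel f I J (relabel (inv_into I f) J I q)) ` Q = (\<lambda>q. q) ` Q"
    by (intro image_cong refl relabel_inverse(2)[OF assms(1)] subsetD[OF assms(2)])
  then show ?thesis by (simp add: image_image)
qed

lemma linear_relabel: "linear (relabel f I J)"
  by (rule linearI) (simp_all add: relabel_def scaleR_fun_def fun_eq_iff)

lemma pairing_relabel:
  assumes "bij_betw f I J"
  shows "pairing J (relabel f I J y) (relabel f I J p) = pairing I y p"
proof -
  have "pairing J (relabel f I J y) (relabel f I J p) =
      (\<Sum>i\<in>I. relabel f I J y (f i) * relabel f I J p (f i))"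
    unfolding pairing_def by (rule sum.reindex_bij_betw[OF assms, symmetric])
  also have "\<dots> = pairing I y p"
    unfolding pairing_def by (intro sum.cong refl) (simp add: relabel_apply[OF assms])
  finally show ?thesis .
qed

lemma relabel_in_polytopes:
  assumes "P \<in> polytopes I"
  shows "relabel f I J ` P \<in> polytopes J"
proof -
  have "relabel f I J ` P \<subseteq> RR J" by (rule image_subsetI) (rule relabel_in_RR)
  moreover have "polytope (relabel f I J ` P)"
    by (rule polytope_linear_image[OF linear_relabel]) (use assms in \<open>simp add: polytopes_def\<close>)
  ultimately show ?thesis by (simp add: polytopes_def)
qed

lemma normal_cone_relabel:
  assumes "bij_betw f I J"
  shows "normal_cone J (relabel f I J ` P) (relabel f I J ` W) = relabel f I J ` normal_cone I P W"
proof
  let ?r = "relabel f I J"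
  have iff: "?r y \<in> normal_cone J (?r ` P) (?r ` W) \<longleftrightarrow> y \<in> normal_cone I P W"
    if "y \<in> RR I" for y
    using that by (simp add: normal_cone_def relabel_in_RR pairing_relabel[OF assms])
  show "?r ` normal_cone I P W \<subseteq> normal_cone J (?r ` P) (?r ` W)"
  proof (rule image_subsetI)
    fix y assume y: "y \<in> normal_cone I P W"
    then have "y \<in> RR I" by (simp add: normal_cone_def)
    with y show "?r y \<in> normal_cone J (?r ` P) (?r ` W)" using iff by simp
  qed
  show "normal_cone J (?r ` P) (?r ` W) \<subseteq> ?r ` normal_cone I P W"
  proof
    fix y assume y: "y \<in> normal_cone J (?r ` P) (?r ` W)"
    define x where "x = relabel (inv_into I f) J I y"
    have "y \<in> RR J" using y by (simp add: normal_cone_def)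
    then have yx: "y = ?r x" by (simp add: x_def relabel_inverse(2)[OF assms])
    moreover have "x \<in> RR I" unfolding x_def by (rule relabel_in_RR)
    ultimately have "x \<in> normal_cone I P W" using y iff by simp
    with yx show "y \<in> ?r ` normal_cone I P W" by (rule image_eqI)
  qed
qed

lemma normal_fan_relabel:
  assumes "bij_betw f I J" and P: "P \<in> polytopes I"
  shows "normal_fan J (relabel f I J ` P) = (\<lambda>N. relabel f I J ` N) ` normal_fan I P"
proof -
  let ?r = "relabel f I J"
  have "normal_fan J (?r ` P) = normal_cone J (?r ` P) ` {W. W \<subseteq> ?r ` P \<and> W \<noteq> {}}"
    using normal_fan_eq[OF polytopes_convex[OF relabel_in_polytopes[OF P]], of J f J]
    by (simp add: setcompr_eq_image)
  also have "{W. W \<subseteq> ?r ` P \<and> W \<noteq> {}} = (\<lambda>W. ?r ` W) ` {W. W \<subseteq> P \<and> W \<noteq> {}}"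
  proof (intro equalityI subsetI)
    fix U assume "U \<in> {W. W \<subseteq> ?r ` P \<and> W \<noteq> {}}"
    then obtain W where W: "W \<subseteq> P" "U = ?r ` W" "U \<noteq> {}"
      by (auto simp: subset_image_iff)
    show "U \<in> (\<lambda>W. ?r ` W) ` {W. W \<subseteq> P \<and> W \<noteq> {}}"
      unfolding W(2) by (rule imageI) (use W in simp)
  next
    fix U assume "U \<in> (\<lambda>W. ?r ` W) ` {W. W \<subseteq> P \<and> W \<noteq> {}}"
    then obtain W where "W \<subseteq> P" "W \<noteq> {}" "U = ?r ` W" by auto
    then show "U \<in> {W. W \<subseteq> ?r ` P \<and> W \<noteq> {}}" by (simp add: image_mono)
  qed
  also have "normal_cone J (?r ` P) ` (\<lambda>W. ?r ` W) ` {W. W \<subseteq> P \<and> W \<noteq> {}} =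
      (\<lambda>N. ?r ` N) ` normal_cone I P ` {W. W \<subseteq> P \<and> W \<noteq> {}}"
    by (simp only: image_image normal_cone_relabel[OF assms(1)])
  also have "normal_cone I P ` {W. W \<subseteq> P \<and> W \<noteq> {}} = normal_fan I P"
    using normal_fan_eq[OF polytopes_convex[OF P], of I] by (simp add: setcompr_eq_image)
  finally show ?thesis .
qed

lemma normal_equiv_relabel:
  assumes "bij_betw f I J" "(P, Q) \<in> normal_equiv I"
  shows "(relabel f I J ` P, relabel f I J ` Q) \<in> normal_equiv J"
  using assms(2) by (simp add: normal_equiv_def relabel_in_polytopes normal_fan_relabel[OF assms(1)])

text \<open>\<open>class_relabel\<close> takes images of the members without closing up under
  equivalence. The image is nevertheless a whole class: a polytope equivalent to the relabeled
  \<open>P\<close> is the relabeling of its own inverse relabeling, which is equivalent to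
  \<open>P\<close>.\<close>

lemma class_relabel_class:
  assumes f: "bij_betw f I J" and P: "P \<in> polytopes I"
  shows "class_relabel f I J (normal_equiv I `` {P}) = normal_equiv J `` {relabel f I J ` P}"
proof
  let ?r = "relabel f I J" and ?s = "relabel (inv_into I f) J I"
  show "class_relabel f I J (normal_equiv I `` {P}) \<subseteq> normal_equiv J `` {?r ` P}"
    unfolding class_relabel_def using normal_equiv_relabel[OF f] by (intro image_subsetI) simp
  show "normal_equiv J `` {?r ` P} \<subseteq> class_relabel f I J (normal_equiv I `` {P})"
  proof
    fix Q assume "Q \<in> normal_equiv J `` {?r ` P}"
    then have Q: "(?r ` P, Q) \<in> normal_equiv J" by simp
    then have "(?s ` ?r ` P, ?s ` Q) \<in> normal_equiv I"
      by (rule normal_equiv_relabel[OF bij_betw_inv_into[OF f]])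
    moreover have "?s ` ?r ` P = P"
    proof -
      have "P \<subseteq> RR I" using P by (simp add: polytopes_def)
      then have "(\<lambda>p. ?s (?r p)) ` P = (\<lambda>p. p) ` P"
        by (intro image_cong refl relabel_inverse(1)[OF f]) (rule subsetD)
      then show ?thesis by (simp add: image_image)
    qed
    moreover have "?r ` ?s ` Q = Q"
      using Q by (intro relabel_image_inverse[OF f]) (simp add: normal_equiv_def polytopes_def)
    ultimately show "Q \<in> class_relabel f I J (normal_equiv I `` {P})"
      unfolding class_relabel_def by (intro image_eqI[of _ _ "?s ` Q"]) simp_all
  qed
qed

lemma relabel_orbit_subset:
  assumes "bij_betw f I J" "q \<in> RR I"
  shows "relabel f I J ` orbit I q \<subseteq> orbit J (relabel f I J q)"
proof (rule image_subsetI)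
  fix v assume "v \<in> orbit I q"
  then obtain \<sigma> where \<sigma>: "\<sigma> permutes I" and v: "v = q \<circ> \<sigma>" by (auto simp: orbit_def)
  \<comment> \<open>The conjugate of \<open>\<sigma>\<close> by \<open>f\<close>, extended by the
    identity.\<close>
  define \<rho> where "\<rho> = (\<lambda>j. if j \<in> J then f (\<sigma> (inv_into I f j)) else j)"
  have \<rho>: "\<rho> permutes J"
    unfolding \<rho>_def by (rule permutes_bij_inv_into[OF \<sigma> assms(1)])
  have "relabel f I J v = relabel f I J q \<circ> \<rho>"
  proof (rule relabel_eqI[OF assms(1)])
    show "v \<in> RR I" using assms(2) permutes_not_in[OF \<sigma>] by (simp add: v RR_def)
    show "relabel f I J q \<circ> \<rho> \<in> RR J"
      using permutes_not_in[OF \<rho>] by (simp add: relabel_def RR_def)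
    fix i assume i: "i \<in> I"
    then have "\<rho> (f i) = f (\<sigma> i)"
      using bij_betw_apply[OF assms(1) i] bij_betw_imp_inj_on[OF assms(1)] by (simp add: \<rho>_def)
    moreover have "\<sigma> i \<in> I" using \<sigma> i by (simp add: permutes_in_image)
    ultimately show "(relabel f I J q \<circ> \<rho>) (f i) = v i"
      by (simp add: v relabel_apply[OF assms(1)])
  qed
  then show "relabel f I J v \<in> orbit J (relabel f I J q)"
    unfolding orbit_def using \<rho> by (intro CollectI exI[of _ \<rho>] conjI)
qed

lemma relabel_orbit_polytope:
  assumes f: "bij_betw f I J" and q: "q \<in> RR I"
  shows "relabel f I J ` orbit_polytope I q = orbit_polytope J (relabel f I J q)"
proof -
  let ?r = "relabel f I J" and ?s = "relabel (inv_into I f) J I"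
  have "?s ` orbit J (?r q) \<subseteq> orbit I (?s (?r q))"
    by (rule relabel_orbit_subset[OF bij_betw_inv_into[OF f] relabel_in_RR])
  then have "?r ` ?s ` orbit J (?r q) \<subseteq> ?r ` orbit I q"
    unfolding relabel_inverse(1)[OF f q] by (rule image_mono)
  then have "orbit J (?r q) \<subseteq> ?r ` orbit I q"
    unfolding relabel_image_inverse[OF f orbit_subset_RR[OF relabel_in_RR]] .
  with relabel_orbit_subset[OF f q] have "?r ` orbit I q = orbit J (?r q)"
    by (rule equalityI)
  then show ?thesis
    unfolding orbit_polytope_eq convex_hull_linear_image[OF linear_relabel] by simp
qed

text \<open>A product is relabeled by one bijection on all labels, while each factor has its own
  label set. Injectivity keeps labels outside \<open>S\<close> from landing in the image of
  \<open>S\<close>, so both relabelings vanish at their images.\<close>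

lemma relabel_superset:
  assumes "inj_on f U" "S \<subseteq> U" "p \<in> RR S"
  shows "relabel f U (f ` U) p = relabel f S (f ` S) p"
proof (rule relabel_eqI)
  have S: "bij_betw f S (f ` S)" using assms(1,2) by (auto simp: bij_betw_def inj_on_subset)
  show "bij_betw f U (f ` U)" using assms(1) by (simp add: bij_betw_def)
  show "p \<in> RR U" using RR_mono[OF assms(2)] assms(3) by (rule subsetD)
  show "relabel f S (f ` S) p \<in> RR (f ` U)"
    using RR_mono[OF image_mono[OF assms(2)]] relabel_in_RR by (rule subsetD)
  fix i assume i: "i \<in> U"
  show "relabel f S (f ` S) p (f i) = p i"
  proof (cases "i \<in> S")
    case True
    then show ?thesis by (rule relabel_apply[OF S])
  next
    case False
    then have "f i \<notin> f ` S" using assms(1,2) i by (auto dest: inj_onD)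
    then show ?thesis using assms(3) False by (simp add: relabel_def RR_def)
  qed
qed

lemma linear_image_polytope_mult:
  assumes "linear h"
  shows "h ` polytope_mult P Q = polytope_mult (h ` P) (h ` Q)"
proof (intro equalityI subsetI)
  fix x assume "x \<in> h ` polytope_mult P Q"
  then obtain z where z: "z \<in> polytope_mult P Q" "x = h z" by auto
  from z(1) obtain p q where "p \<in> P" "q \<in> Q" "z = p + q" by (rule polytope_multE)
  then show "x \<in> polytope_mult (h ` P) (h ` Q)"
    unfolding z(2) by (simp add: linear_add[OF assms] polytope_multI)
next
  fix x assume "x \<in> polytope_mult (h ` P) (h ` Q)"
  then obtain a b where ab: "a \<in> h ` P" "b \<in> h ` Q" "x = a + b" by (rule polytope_multE)
  then obtain p q where pq: "p \<in> P" "q \<in> Q" "x = h (p + q)"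
    by (auto simp: linear_add[OF assms])
  show "x \<in> h ` polytope_mult P Q"
    using pq(3) polytope_multI[OF pq(1,2)] by (rule image_eqI)
qed

lemma orbit_product_relabel:
  assumes "orbit_product I P" "bij_betw f I J"
  shows "orbit_product J (relabel f I J ` P)"
  using assms
proof (induction arbitrary: J rule: orbit_product.induct)
  case empty
  then have "J = {}" by (simp add: bij_betw_def)
  moreover have "relabel f {} {} ` {0} = {0}" by (simp add: relabel_def fun_eq_iff)
  ultimately show ?case using orbit_product.empty by (simp only:)
next
  case (mult S P T q)
  let ?U = "S \<union> T"
  have inj: "inj_on f ?U" and J: "J = f ` ?U" using mult.prems by (auto simp: bij_betw_def)
  have S: "bij_betw f S (f ` S)" and T: "bij_betw f T (f ` T)"
    using inj by (auto simp: bij_betw_def inj_on_Un)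
  have "P \<subseteq> RR S" using orbit_product_in_polytopes[OF mult.hyps(1)] by (simp add: polytopes_def)
  then have 1: "relabel f ?U J ` P = relabel f S (f ` S) ` P"
    unfolding J by (intro image_cong refl relabel_superset[OF inj]) (auto simp only: Un_upper1 subsetD)
  have "orbit_polytope T q \<subseteq> RR T"
    using orbit_polytope_in_polytopes[OF mult.hyps(2,4)] by (simp add: polytopes_def)
  then have "relabel f ?U J ` orbit_polytope T q = relabel f T (f ` T) ` orbit_polytope T q"
    unfolding J by (intro image_cong refl relabel_superset[OF inj]) (auto simp only: Un_upper2 subsetD)
  also have "\<dots> = orbit_polytope (f ` T) (relabel f T (f ` T) q)"
    by (rule relabel_orbit_polytope[OF T mult.hyps(4)])
  finally have 2: "relabel f ?U J ` orbit_polytope T q =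
      orbit_polytope (f ` T) (relabel f T (f ` T) q)" .
  have "f ` S \<inter> f ` T = {}" using inj_on_image_Int[OF inj, of S T] mult.hyps(3) by simp
  then have "orbit_product (f ` S \<union> f ` T)
      (polytope_mult (relabel f S (f ` S) ` P) (orbit_polytope (f ` T) (relabel f T (f ` T) q)))"
    by (intro orbit_product.mult mult.IH[OF S] relabel_in_RR finite_imageI mult.hyps(2))
  then show ?case
    unfolding linear_image_polytope_mult[OF linear_relabel] 1 2 by (simp add: J image_Un)
qed

section \<open>Braid chambers and membership in \<open>GP\<close>\<close>

text \<open>Read contrapositively, \<open>y\<close> satisfies every weak inequality that holds
  between coordinates of \<open>y\<^sub>0\<close>. This is the closed braid cone with
  \<open>y\<^sub>0\<close> in its relative interior, a chamber when the coordinates of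
  \<open>y\<^sub>0\<close> on \<open>I\<close> are distinct.\<close>

definition closed_chamber :: "'a set \<Rightarrow> ('a \<Rightarrow> real) \<Rightarrow> ('a \<Rightarrow> real) set"
  where "closed_chamber I y\<^sub>0 = {y \<in> RR I. \<forall>i\<in>I. \<forall>j\<in>I. y i < y j \<longrightarrow> y\<^sub>0 i < y\<^sub>0 j}"

text \<open>Choose \<open>v\<close> in the orbit maximizing \<open>y\<^sub>0\<close>. A strict
  inequality in \<open>y\<close> is one in \<open>y\<^sub>0\<close>, hence a weak one in
  \<open>v\<close>, so every \<open>y\<close> in the chamber is maximal at the same
  \<open>v\<close>.\<close>

lemma orbit_polytope_chamber:
  assumes "finite T"
  shows "\<exists>v\<in>orbit_polytope T q. closed_chamber T y\<^sub>0 \<subseteq> normal_cone T (orbit_polytope T q) {v}"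
proof -
  let ?M = "Max (pairing T y\<^sub>0 ` orbit T q)"
  have fin: "finite (pairing T y\<^sub>0 ` orbit T q)" using finite_orbit[OF assms] by simp
  moreover have "pairing T y\<^sub>0 ` orbit T q \<noteq> {}" using self_in_orbit[of q T] by auto
  ultimately have "?M \<in> pairing T y\<^sub>0 ` orbit T q" by (rule Max_in)
  then obtain v where v: "v \<in> orbit T q" and M: "?M = pairing T y\<^sub>0 v" by auto
  have "\<forall>z\<in>orbit T q. pairing T y\<^sub>0 z \<le> pairing T y\<^sub>0 v"
    unfolding M[symmetric] using Max_ge[OF fin] by simp
  then have "comonotone T y\<^sub>0 v" by (simp add: maximal_on_orbit_iff[OF assms v])
  then have "comonotone T y v" if "y \<in> closed_chamber T y\<^sub>0" for y
    using that by (simp add: comonotone_def closed_chamber_def)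
  moreover have "normal_cone T (orbit T q) {v} = {y \<in> RR T. comonotone T y v}"
    using normal_cone_orbit[OF assms, of "{v}" q] v by simp
  ultimately have "closed_chamber T y\<^sub>0 \<subseteq> normal_cone T (orbit_polytope T q) {v}"
    unfolding orbit_polytope_eq normal_cone_convex_hull
    by (intro subsetI) (simp add: closed_chamber_def)
  moreover have "v \<in> orbit_polytope T q" unfolding orbit_polytope_eq by (rule hull_inc[OF v])
  ultimately show ?thesis by (rule bexI)
qed

text \<open>One \<open>y\<^sub>0\<close> serves all factors: the defining condition of the chamber
  passes to subsets of labels, so the points found in the factors can simply be added.\<close>

lemma orbit_product_chamber:
  assumes "orbit_product I P"
  shows "\<exists>v\<in>P. closed_chamber I y\<^sub>0 \<subseteq> normal_cone I P {v}"
  using assms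
proof (induction rule: orbit_product.induct)
  case empty
  show ?case
    by (rule bexI[of _ 0], rule subsetI) (simp_all add: closed_chamber_def normal_cone_def pairing_def)
next
  case (mult S P T q)
  let ?Q = "orbit_polytope T q"
  obtain v where v: "v \<in> P" "closed_chamber S y\<^sub>0 \<subseteq> normal_cone S P {v}" using mult.IH by auto
  obtain w where w: "w \<in> ?Q" "closed_chamber T y\<^sub>0 \<subseteq> normal_cone T ?Q {w}"
    using orbit_polytope_chamber[OF mult.hyps(2), of q y\<^sub>0] by auto
  have sub: "P \<subseteq> RR S" "?Q \<subseteq> RR T"
    using orbit_product_in_polytopes[OF mult.hyps(1)] orbit_polytope_in_polytopes[OF mult.hyps(2,4)]
    by (simp_all add: polytopes_def)
  have vw: "v + w \<in> polytope_mult P ?Q" by (rule polytope_multI[OF v(1) w(1)])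
  then have "normal_cone (S \<union> T) (polytope_mult P ?Q) {v + w} =
      join_cone S T (normal_cone S P {v}) (normal_cone T ?Q {w})"
    using normal_cone_mult[OF orbit_product_finite[OF mult.hyps(1)] mult.hyps(2,3) sub, of "{v + w}"]
      restrict_vec_add[OF mult.hyps(3) sub v(1) w(1)] by simp
  moreover have "closed_chamber (S \<union> T) y\<^sub>0 \<subseteq>
      join_cone S T (normal_cone S P {v}) (normal_cone T ?Q {w})"
  proof
    fix y assume y: "y \<in> closed_chamber (S \<union> T) y\<^sub>0"
    then have "restrict_vec S y \<in> closed_chamber S y\<^sub>0" "restrict_vec T y \<in> closed_chamber T y\<^sub>0"
      by (simp_all add: closed_chamber_def restrict_vec_in_RR) (simp_all add: restrict_vec_def)
    then have "restrict_vec S y \<in> normal_cone S P {v}" "restrict_vec T y \<in> normal_cone T ?Q {w}"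
      using subsetD[OF v(2)] subsetD[OF w(2)] by simp_all
    with y show "y \<in> join_cone S T (normal_cone S P {v}) (normal_cone T ?Q {w})"
      by (simp add: join_cone_def closed_chamber_def)
  qed
  ultimately show ?case using vw by (intro bexI[of _ "v + w"]) (simp_all only:)
qed

lemma continuous_on_coordinate: "continuous_on A (\<lambda>y :: 'a \<Rightarrow> real. y i)"
  by (rule continuous_on_subset[OF continuous_on_product_coordinates]) simp

lemma closed_RR: "closed (RR I)"
  unfolding RR_def
  by (intro closed_Collect_all closed_Collect_imp closed_Collect_eq continuous_on_coordinate
      continuous_on_const) simp_all

text \<open>On a connected subset of the braid complement the difference of two coordinates never
  vanishes, so by the intermediate value theorem it keeps its sign.\<close>

lemma braid_component_order:
  assumes R: "R \<in> components (braid_complement I)" and y: "y \<in> R" "y' \<in> R"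
    and ij: "i \<in> I" "j \<in> I" and less: "y i < y j"
  shows "y' i < y' j"
proof (rule ccontr)
  assume "\<not> y' i < y' j"
  define g where "g = (\<lambda>z :: 'a \<Rightarrow> real. z j - z i)"
  have "continuous_on R g"
    unfolding g_def by (intro continuous_on_diff continuous_on_coordinate)
  then have "connected (g ` R)"
    using in_components_connected[OF R] by (rule connected_continuous_image)
  moreover have "g y' \<in> g ` R" "g y \<in> g ` R" using y by simp_all
  ultimately have "{g y'..g y} \<subseteq> g ` R" by (rule connected_contains_Icc)
  moreover have "0 \<in> {g y'..g y}" using less \<open>\<not> y' i < y' j\<close> by (simp add: g_def)
  ultimately have "0 \<in> g ` R" by (rule subsetD)
  then obtain z where z: "z \<in> R" "z i = z j" by (auto simp: g_def)
  have "z \<in> braid_complement I" using in_components_subset[OF R] z(1) by (rule subsetD)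
  moreover have "z \<in> braid_hyperplane I i j"
    using calculation z(2) by (simp add: braid_complement_def braid_hyperplane_def)
  moreover have "i \<noteq> j" using less by auto
  ultimately show False using ij unfolding braid_complement_def by blast
qed

text \<open>Strict inequalities may become equalities in the closure but cannot be reversed, because
  weak inequalities define closed sets. This inclusion is the direction that bounds braid cones from
  above.\<close>

lemma closure_braid_component:
  assumes R: "R \<in> components (braid_complement I)" and y0: "y\<^sub>0 \<in> R"
  shows "closure R \<subseteq> closed_chamber I y\<^sub>0"
proof
  fix y assume y: "y \<in> closure R"
  have "R \<subseteq> RR I"
    using in_components_subset[OF R] unfolding braid_complement_def by (rule order_trans) simp
  then have "closure R \<subseteq> RR I" using closed_RR by (rule closure_minimal)
  then have "y \<in> RR I" using y by (rule subsetD)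
  moreover have "y\<^sub>0 i < y\<^sub>0 j" if ij: "i \<in> I" "j \<in> I" and less: "y i < y j" for i j
  proof (rule ccontr)
    assume "\<not> y\<^sub>0 i < y\<^sub>0 j"
    have "R \<subseteq> {z. z j \<le> z i}"
    proof
      fix z assume "z \<in> R"
      then have "\<not> z i < z j"
        using braid_component_order[OF R _ y0 ij] \<open>\<not> y\<^sub>0 i < y\<^sub>0 j\<close> by auto
      then show "z \<in> {z. z j \<le> z i}" by simp
    qed
    moreover have "closed {z :: 'a \<Rightarrow> real. z j \<le> z i}"
      by (intro closed_Collect_le continuous_on_coordinate)
    ultimately have "closure R \<subseteq> {z. z j \<le> z i}" by (rule closure_minimal)
    then have "y \<in> {z. z j \<le> z i}" using y by (rule subsetD)
    then show False using less by simp
  qed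
  ultimately show "y \<in> closed_chamber I y\<^sub>0" by (simp add: closed_chamber_def)
qed

text \<open>Among polytopes, membership in \<open>GP\<close> depends only on the fan, so it passes
  from \<open>P\<close> to all of its class. A braid cone lies in the closure of a component, hence
  in the cone of a single point of \<open>P\<close>.\<close>

lemma orbit_product_class_in_GP:
  assumes "orbit_product I P" and "(P, Q) \<in> normal_equiv I"
  shows "Q \<in> GP I"
proof -
  have Q: "Q \<in> polytopes I" "normal_fan I Q = normal_fan I P"
    using assms(2) by (simp_all add: normal_equiv_def)
  have "\<exists>N\<in>normal_fan I P. B \<subseteq> N" if "B \<in> braid_fan I" for B
  proof -
    have "\<exists>R\<in>components (braid_complement I). B face_of closure R"
      using that by (simp add: braid_fan_def)
    then obtain R where R: "R \<in> components (braid_complement I)" and B: "B face_of closure R"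
      by (rule bexE)
    obtain y\<^sub>0 where y0: "y\<^sub>0 \<in> R" using in_components_nonempty[OF R] by auto
    obtain v where v: "v \<in> P" "closed_chamber I y\<^sub>0 \<subseteq> normal_cone I P {v}"
      using orbit_product_chamber[OF assms(1)] by auto
    have "B \<subseteq> normal_cone I P {v}"
      using face_of_imp_subset[OF B] closure_braid_component[OF R y0] v(2) by (meson order_trans)
    moreover have "normal_cone I P {v} \<in> normal_fan I P"
      unfolding normal_fan_eq[OF polytopes_convex[OF orbit_product_in_polytopes[OF assms(1)]]]
      using v(1) by (intro CollectI exI[of _ "{v}"]) simp
    ultimately show ?thesis by (rule bexI)
  qed
  with Q show ?thesis by (simp add: GP_def)
qed

section \<open>The character on classes and its uniqueness\<close>

lemma orbit_class_eq:
  assumes "finite I" "p \<in> RR I"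
  shows "orbit_class (composition_of I p) I = normal_equiv I `` {orbit_polytope I p}"
proof
  let ?X = "{orbit_polytope I q |q. q \<in> RR I \<and> composition_of I q = composition_of I p}"
  show "orbit_class (composition_of I p) I \<subseteq> normal_equiv I `` {orbit_polytope I p}"
  proof
    fix Q assume "Q \<in> orbit_class (composition_of I p) I"
    then obtain q where q: "q \<in> RR I" "composition_of I p = composition_of I q"
      and Q: "(orbit_polytope I q, Q) \<in> normal_equiv I"
      by (auto simp: orbit_class_def)
    then show "Q \<in> normal_equiv I `` {orbit_polytope I p}"
      using orbit_polytopes_normal_equiv[OF assms q] by (simp add: normal_equiv_def)
  qed
  have "orbit_polytope I p \<in> ?X" using assms(2) by (intro CollectI exI[of _ p]) simp
  then show "normal_equiv I `` {orbit_polytope I p} \<subseteq> orbit_class (composition_of I p) I"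
    unfolding orbit_class_def by (intro Image_mono subset_refl) simp
qed

text \<open>The existential avoids choosing a representative; on a class it agrees with the
  universal version, since equivalent polytopes are points simultaneously. The nested restrictions
  provide the extensionality demanded by \<open>OP_characters\<close>.\<close>

definition point_character :: "'a set \<Rightarrow> ('a \<Rightarrow> real) set set \<Rightarrow> 'k::field"
  where "point_character =
    (\<lambda>I\<in>{I. finite I}. \<lambda>x\<in>OP_bar I. if \<exists>P\<in>x. \<exists>p. P = {p} then 1 else 0)"

lemma OP_barE:
  assumes "x \<in> OP_bar I"
  obtains P where "orbit_product I P" "x = normal_equiv I `` {P}"
  using assms by (auto simp: OP_bar_def)

lemma OP_barI: "orbit_product I P \<Longrightarrow> normal_equiv I `` {P} \<in> OP_bar I"
  unfolding OP_bar_def by (intro CollectI exI[of _ P]) simp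

lemma normal_equiv_singleton_iff:
  assumes "finite I" "(P, Q) \<in> normal_equiv I"
  shows "(\<exists>p. Q = {p}) \<longleftrightarrow> (\<exists>p. P = {p})"
  using assms by (simp add: normal_equiv_def singleton_iff_normal_fan)

text \<open>The representative \<open>Q\<close> is kept apart from the generator \<open>P\<close>
  because restricting the basic character speaks of every member of the class.\<close>

lemma point_character_class:
  assumes "orbit_product I P" "(P, Q) \<in> normal_equiv I"
  shows "point_character I (normal_equiv I `` {P}) = (if \<exists>q. Q = {q} then 1 else 0)"
proof -
  have fin: "finite I" using assms(1) by (rule orbit_product_finite)
  have "(\<exists>R\<in>normal_equiv I `` {P}. \<exists>p. R = {p}) \<longleftrightarrow> (\<exists>p. P = {p})"
  proof
    assume "\<exists>R\<in>normal_equiv I `` {P}. \<exists>p. R = {p}"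
    then obtain R where "(P, R) \<in> normal_equiv I" "\<exists>p. R = {p}" by auto
    then show "\<exists>p. P = {p}" by (simp add: normal_equiv_singleton_iff[OF fin])
  next
    assume "\<exists>p. P = {p}"
    then have "\<exists>p. Q = {p}" by (simp add: normal_equiv_singleton_iff[OF fin assms(2)])
    then show "\<exists>R\<in>normal_equiv I `` {P}. \<exists>p. R = {p}"
      using assms(2) by (intro bexI[of _ Q]) simp_all
  qed
  also have "\<dots> \<longleftrightarrow> (\<exists>q. Q = {q})" by (simp only: normal_equiv_singleton_iff[OF fin assms(2)])
  finally show ?thesis
    using fin OP_barI[OF assms(1)] by (simp only: point_character_def restrict_apply mem_Collect_eq if_True)
qed

lemma normal_equiv_refl: "orbit_product I P \<Longrightarrow> (P, P) \<in> normal_equiv I"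
  using orbit_product_in_polytopes[of I P] by (simp add: normal_equiv_def)

lemma orbit_product_empty_iff: "orbit_product {} P \<longleftrightarrow> P = {0}"
proof
  assume "orbit_product {} P"
  then have "P \<subseteq> {0}" "P \<noteq> {}"
    using orbit_product_in_polytopes[of "{}" P] orbit_product_nonempty[of "{}" P]
    by (auto simp: polytopes_def RR_def fun_eq_iff)
  then show "P = {0}" by (simp only: subset_singleton_iff simp_thms)
qed (simp add: orbit_product.empty)

lemma point_character_in_OP_characters:
  "(point_character :: 'a set \<Rightarrow> ('a \<Rightarrow> real) set set \<Rightarrow> 'k::field) \<in> OP_characters"
  unfolding OP_characters_def
proof (intro CollectI conjI allI impI ballI)
  show "point_character \<in> (\<Pi>\<^sub>E I\<in>{I. finite I}. OP_bar I \<rightarrow>\<^sub>E UNIV)"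
    unfolding point_character_def by (intro restrict_PiE_iff[THEN iffD2] ballI) simp
next
  fix I J :: "'a set" and f x
  assume *: "finite I \<and> finite J \<and> bij_betw f I J \<and> x \<in> OP_bar I"
  then have f: "bij_betw f I J" by simp
  obtain P where P: "orbit_product I P" "x = normal_equiv I `` {P}"
    using * by (auto elim: OP_barE)
  note rP = orbit_product_relabel[OF P(1) f]
  \<comment> \<open>Injectivity preserves cardinality, and being a point means having cardinality
    one.\<close>
  have "inj_on (relabel f I J) P"
  proof (rule inj_on_inverseI)
    fix p assume "p \<in> P"
    moreover have "P \<subseteq> RR I"
      using orbit_product_in_polytopes[OF P(1)] by (simp add: polytopes_def)
    ultimately show "relabel (inv_into I f) J I (relabel f I J p) = p"
      by (intro relabel_inverse(1)[OF f]) (rule subsetD)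
  qed
  then have "(\<exists>q. relabel f I J ` P = {q}) \<longleftrightarrow> (\<exists>p. P = {p})"
    by (metis card_1_singleton_iff card_image)
  then show "point_character J (class_relabel f I J x) = (point_character I x :: 'k)"
    unfolding P(2) class_relabel_class[OF f orbit_product_in_polytopes[OF P(1)]]
      point_character_class[OF rP normal_equiv_refl[OF rP]]
      point_character_class[OF P(1) normal_equiv_refl[OF P(1)]] by (simp only:)
next
  fix x :: "('a \<Rightarrow> real) set set"
  assume "x \<in> OP_bar {}"
  then obtain P where P: "orbit_product {} P" "x = normal_equiv {} `` {P}" by (rule OP_barE)
  then have "\<exists>p. P = {p}" unfolding orbit_product_empty_iff by (intro exI[of _ 0])
  then show "point_character {} x = (1 :: 'k)"
    unfolding P(2) point_character_class[OF P(1) normal_equiv_refl[OF P(1)]] by (rule if_P)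
next
  fix S T :: "'a set" and x y
  assume *: "finite S \<and> finite T \<and> S \<inter> T = {} \<and> x \<in> OP_bar S \<and> y \<in> OP_bar T"
  then have fin: "finite S" "finite T" "S \<inter> T = {}" by simp_all
  obtain P where P: "orbit_product S P" "x = normal_equiv S `` {P}"
    using * by (auto elim: OP_barE)
  obtain Q where Q: "orbit_product T Q" "y = normal_equiv T `` {Q}"
    using * by (auto elim: OP_barE)
  note PT = orbit_product_in_polytopes[OF P(1)] orbit_product_in_polytopes[OF Q(1)]
  note PQ = orbit_product_mult[OF Q(1) P(1) fin(3)]
  have "(\<exists>x. polytope_mult P Q = {x}) \<longleftrightarrow> (\<exists>p. P = {p}) \<and> (\<exists>q. Q = {q})"
    using PT orbit_product_nonempty[OF P(1)] orbit_product_nonempty[OF Q(1)]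
    by (intro polytope_mult_singleton_iff[OF fin(3)]) (simp_all add: polytopes_def)
  then show "point_character (S \<union> T) (class_mult S T x y) =
      point_character S x * (point_character T y :: 'k)"
    unfolding P(2) Q(2) class_mult_classes[OF fin PT]
      point_character_class[OF PQ normal_equiv_refl[OF PQ]]
      point_character_class[OF P(1) normal_equiv_refl[OF P(1)]]
      point_character_class[OF Q(1) normal_equiv_refl[OF Q(1)]] by simp
qed

lemma has_one_part_values_point_character:
  "has_one_part_values (point_character :: 'a set \<Rightarrow> ('a \<Rightarrow> real) set set \<Rightarrow> 'k::field)"
  unfolding has_one_part_values_def
proof (intro allI impI)
  fix I :: "'a set" and \<alpha>
  assume *: "finite I \<and> I \<noteq> {} \<and> is_composition \<alpha> (card I)"
  then obtain p where p: "p \<in> RR I" "composition_of I p = \<alpha>"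
    using ex_composition_of[of I \<alpha>] by auto
  have O: "orbit_product I (orbit_polytope I p)"
    using * p(1) by (intro orbit_product_orbit_polytope) simp_all
  have "(\<exists>x. orbit_polytope I p = {x}) \<longleftrightarrow> length \<alpha> = 1"
    using * orbit_polytope_singleton_iff[of I p] length_composition_of[of I p] p(2) by simp
  moreover have "orbit_class \<alpha> I = normal_equiv I `` {orbit_polytope I p}"
    using orbit_class_eq[of I p] * p by simp
  ultimately show "point_character I (orbit_class \<alpha> I) = (if length \<alpha> = 1 then 1 else 0 :: 'k)"
    using point_character_class[OF O normal_equiv_refl[OF O]] by (simp only:)
qed

lemma is_restriction_of_basic_point_character:
  "is_restriction_of_basic (point_character :: 'a set \<Rightarrow> ('a \<Rightarrow> real) set set \<Rightarrow> 'k::field)"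
  unfolding is_restriction_of_basic_def
proof (intro allI impI ballI)
  fix I :: "'a set" and x Q
  assume fin: "finite I" and "x \<in> OP_bar I" and Q: "Q \<in> x"
  then obtain P where P: "orbit_product I P" "x = normal_equiv I `` {P}" by (auto elim: OP_barE)
  have PQ: "(P, Q) \<in> normal_equiv I" using Q P(2) by simp
  have GP: "Q \<in> GP I" by (rule orbit_product_class_in_GP[OF P(1) PQ])
  moreover have "point_character I x = (basic_character I Q :: 'k)"
    unfolding P(2) point_character_class[OF P(1) PQ]
    using fin GP by (simp only: basic_character_def restrict_apply mem_Collect_eq if_True)
  ultimately show "Q \<in> GP I \<and> point_character I x = (basic_character I Q :: 'k)" by (rule conjI)
qed

text \<open>A composition of \<open>card T\<close> covers the factor \<open>T\<close> unless \<open>T\<close> is empty, when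
  \<open>has_one_part_values\<close> says nothing and the unit axiom takes over.\<close>

lemma OP_character_eqI:
  fixes \<xi> \<zeta> :: "'a set \<Rightarrow> ('a \<Rightarrow> real) set set \<Rightarrow> 'k::field"
  assumes \<xi>: "\<xi> \<in> OP_characters" "has_one_part_values \<xi>"
    and \<zeta>: "\<zeta> \<in> OP_characters" "has_one_part_values \<zeta>"
  shows "\<xi> = \<zeta>"
proof -
  have unit: "\<phi> {} x = 1" if "\<phi> \<in> OP_characters" "x \<in> OP_bar {}"
    for \<phi> :: "'a set \<Rightarrow> ('a \<Rightarrow> real) set set \<Rightarrow> 'k" and x
    using that by (simp add: OP_characters_def)
  have product: "\<phi> (S \<union> T) (class_mult S T x y) = \<phi> S x * \<phi> T y"
    if "\<phi> \<in> OP_characters" "finite S" "finite T" "S \<inter> T = {}" "x \<in> OP_bar S" "y \<in> OP_bar T"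
    for \<phi> :: "'a set \<Rightarrow> ('a \<Rightarrow> real) set set \<Rightarrow> 'k" and S T x y
    using that by (simp add: OP_characters_def)
  have orbit: "\<xi> T (normal_equiv T `` {orbit_polytope T q}) = \<zeta> T (normal_equiv T `` {orbit_polytope T q})"
    if T: "finite T" and q: "q \<in> RR T" for T q
  proof (cases "T = {}")
    case True
    have "normal_equiv T `` {orbit_polytope T q} \<in> OP_bar T"
      by (intro OP_barI orbit_product_orbit_polytope that)
    then show ?thesis using unit[OF \<xi>(1)] unit[OF \<zeta>(1)] True by simp
  next
    case False
    then show ?thesis
      using \<xi>(2) \<zeta>(2) T is_composition_composition_of[OF T, of q]
      unfolding orbit_class_eq[OF that, symmetric] has_one_part_values_def by simp
  qed
  have eq: "\<xi> I (normal_equiv I `` {P}) = \<zeta> I (normal_equiv I `` {P})" if "orbit_product I P" for I P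
    using that
  proof (induction rule: orbit_product.induct)
    case empty
    show ?case
      by (simp only: unit[OF \<xi>(1) OP_barI[OF orbit_product.empty]]
          unit[OF \<zeta>(1) OP_barI[OF orbit_product.empty]])
  next
    case (mult S P T q)
    note S = orbit_product_finite[OF mult.hyps(1)]
    note O = orbit_product_orbit_polytope[OF mult.hyps(2,4)]
    \<comment> \<open>Used from right to left: the class of the product becomes a product of
      classes, which multiplicativity of both characters splits into the induction hypothesis and
      the case of one orbit polytope.\<close>
    note cl = class_mult_classes[OF S mult.hyps(2,3) orbit_product_in_polytopes[OF mult.hyps(1)]
      orbit_product_in_polytopes[OF O], symmetric]
    show ?case
      unfolding cl product[OF \<xi>(1) S mult.hyps(2,3) OP_barI[OF mult.hyps(1)] OP_barI[OF O]]
        product[OF \<zeta>(1) S mult.hyps(2,3) OP_barI[OF mult.hyps(1)] OP_barI[OF O]]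
      by (simp add: mult.IH orbit[OF mult.hyps(2,4)])
  qed
  have funs: "\<phi> \<in> (\<Pi>\<^sub>E I\<in>{I. finite I}. OP_bar I \<rightarrow>\<^sub>E UNIV)" if "\<phi> \<in> OP_characters"
    for \<phi> :: "'a set \<Rightarrow> ('a \<Rightarrow> real) set set \<Rightarrow> 'k"
    using that by (simp add: OP_characters_def)
  show ?thesis
  proof (rule PiE_ext[OF funs[OF \<xi>(1)] funs[OF \<zeta>(1)]])
    fix I :: "'a set" assume I: "I \<in> {I. finite I}"
    show "\<xi> I = \<zeta> I"
    proof (rule PiE_ext[OF PiE_mem[OF funs[OF \<xi>(1)] I] PiE_mem[OF funs[OF \<zeta>(1)] I]])
      fix x assume "x \<in> OP_bar I"
      then obtain P where "orbit_product I P" "x = normal_equiv I `` {P}" by (rule OP_barE)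
      then show "\<xi> I x = \<zeta> I x" using eq by simp
    qed
  qed
qed

theorem proposition5p7:
  shows "\<exists>\<zeta> :: 'a set \<Rightarrow> ('a \<Rightarrow> real) set set \<Rightarrow> 'k::field.
    \<zeta> \<in> OP_characters \<and> has_one_part_values \<zeta> \<and>
    (\<forall>\<xi>\<in>OP_characters. has_one_part_values \<xi> \<longrightarrow> \<xi> = \<zeta>) \<and>
    is_restriction_of_basic \<zeta>"
proof (intro exI[of _ point_character] conjI ballI impI)
  fix \<xi> :: "'a set \<Rightarrow> ('a \<Rightarrow> real) set set \<Rightarrow> 'k"
  assume "\<xi> \<in> OP_characters" "has_one_part_values \<xi>"
  then show "\<xi> = point_character"
    using point_character_in_OP_characters has_one_part_values_point_character
    by (rule OP_character_eqI)
qed (rule point_character_in_OP_characters has_one_part_values_point_character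
    is_restriction_of_basic_point_character)+

end
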